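(* Let $X$ be a countably infinite set. Every algebraic lattice with at most countably many compact elements is isomorphic to a complete sublattice of $\mathrm{Cl}_{loc}(X)$. In fact, every such lattice is isomorphic to a complete sublattice of $\mathrm{Gr}_{loc}(X)$ and to a complete sublattice of $\mathrm{Mon}_{loc}(X)$.
   Context: For $n\ge 1$, let $\mathscr O^{(n)}=X^{X^n}$ be the set of $n$-ary operations on $X$ and $\mathscr O=\bigcup_{n\ge1}\mathscr O^{(n)}$. A clone on $X$ is a subset of $\mathscr O$ that contains all projections $\pi^n_k(x_1,\dots,x_n)=x_k$ ($1\le k\le n$) and is closed under composition: if $f$ is an $n$-ary member and $g_1,\dots,g_n$ are $m$-ary members, then $f(g_1,\dots,g_n)$ is a member. Equip $X$ with the discrete topology and each $\mathscr O^{(n)}=X^{X^n}$ with the product topology. A clone $\mathscr C$ is local (locally closed) iff $\mathscr C\cap\mathscr O^{(n)}$ is closed in $\mathscr O^{(n)}$ for every $n\ge1$. $\mathrm{Cl}_{loc}(X)$ is the complete lattice of all local clones on $X$ ordered by inclusion. $\mathrm{Gr}_{loc}(X)$ is the complete lattice, ordered by inclusion, of all permutation groups on $X$ that are topologically closed in the space of all permutations of $X$ (with the subspace topology from $X^X$). $\mathrm{Mon}_{loc}(X)$ is the complete lattice, ordered by inclusion, of all transformation monoids on $X$ (subsets of $X^X$ containing the identity and closed under composition) that are closed in $X^X$. Being isomorphic to a complete sublattice means that there is an injective map that preserves arbitrary meets and joins of non-empty families. *)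

theory Defs
  imports "HOL-Analysis.Analysis" "HOL-Algebra.Bij" "HOL-Algebra.Complete_Lattice"
begin

section \<open>Algebraic lattices\<close>

definition compact_element :: "('l, 'm) gorder_scheme \<Rightarrow> 'l \<Rightarrow> bool" where
  "compact_element L c \<longleftrightarrow>
     c \<in> carrier L \<and>
     (\<forall>A\<subseteq>carrier L. c \<sqsubseteq>\<^bsub>L\<^esub> \<Squnion>\<^bsub>L\<^esub>A \<longrightarrow>
        (\<exists>B\<subseteq>A. finite B \<and> c \<sqsubseteq>\<^bsub>L\<^esub> \<Squnion>\<^bsub>L\<^esub>B))"

locale algebraic_lattice = complete_lattice +
  assumes join_of_compact:
    "x \<in> carrier L \<Longrightarrow> \<exists>A. (\<forall>c\<in>A. compact_element L c) \<and> x = \<Squnion>A"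

text \<open>The library predicates \<^const>\<open>weak_sup_pres\<close> and \<^const>\<open>weak_inf_pres\<close> demand that both
  structures are complete lattices and speak about joins and meets of non-empty subsets only,
  so the least and the greatest element need not be preserved.\<close>

definition iso_to_complete_sublattice ::
    "('l, 'm) gorder_scheme \<Rightarrow> ('k, 'n) gorder_scheme \<Rightarrow> bool" where
  "iso_to_complete_sublattice L M \<longleftrightarrow>
     (\<exists>h \<in> carrier L \<rightarrow> carrier M. inj_on h (carrier L) \<and>
        weak_sup_pres L M h \<and> weak_inf_pres L M h)"

abbreviation inclusion_order :: "'s set set \<Rightarrow> 's set gorder" where
  "inclusion_order F \<equiv> \<lparr>carrier = F, eq = (=), le = (\<subseteq>)\<rparr>"


section \<open>Local clones\<close>

definition tuples :: "'a set \<Rightarrow> nat \<Rightarrow> (nat \<Rightarrow> 'a) set" where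
  "tuples X n = {1..n} \<rightarrow>\<^sub>E X"

definition nary_ops :: "'a set \<Rightarrow> nat \<Rightarrow> ((nat \<Rightarrow> 'a) \<Rightarrow> 'a) set" where
  "nary_ops X n = tuples X n \<rightarrow>\<^sub>E X"

definition nary_ops_topology :: "'a set \<Rightarrow> nat \<Rightarrow> ((nat \<Rightarrow> 'a) \<Rightarrow> 'a) topology" where
  "nary_ops_topology X n = product_topology (\<lambda>_. discrete_topology X) (tuples X n)"

text \<open>An operation is tagged with its arity: as functions of type
  \<^typ>\<open>(nat \<Rightarrow> 'a) \<Rightarrow> 'a\<close>, the constant operations of different arities with
  value \<^term>\<open>undefined\<close> would coincide.\<close>

definition operations :: "'a set \<Rightarrow> (nat \<times> ((nat \<Rightarrow> 'a) \<Rightarrow> 'a)) set" where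
  "operations X = (SIGMA n:{1..}. nary_ops X n)"

definition proj_op :: "'a set \<Rightarrow> nat \<Rightarrow> nat \<Rightarrow> (nat \<Rightarrow> 'a) \<Rightarrow> 'a" where
  "proj_op X n k = (\<lambda>x\<in>tuples X n. x k)"

definition comp_op :: "'a set \<Rightarrow> nat \<Rightarrow> nat \<Rightarrow> ((nat \<Rightarrow> 'a) \<Rightarrow> 'a) \<Rightarrow>
    (nat \<Rightarrow> (nat \<Rightarrow> 'a) \<Rightarrow> 'a) \<Rightarrow> (nat \<Rightarrow> 'a) \<Rightarrow> 'a" where
  "comp_op X n m f g = (\<lambda>x\<in>tuples X m. f (\<lambda>i\<in>{1..n}. g i x))"

definition clone :: "'a set \<Rightarrow> (nat \<times> ((nat \<Rightarrow> 'a) \<Rightarrow> 'a)) set \<Rightarrow> bool" where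
  "clone X C \<longleftrightarrow>
     C \<subseteq> operations X \<and>
     (\<forall>n. \<forall>k\<in>{1..n}. (n, proj_op X n k) \<in> C) \<and>
     (\<forall>n m f g. (n, f) \<in> C \<longrightarrow> (\<forall>i\<in>{1..n}. (m, g i) \<in> C) \<longrightarrow> (m, comp_op X n m f g) \<in> C)"

text \<open>The image \<^term>\<open>C `` {n}\<close> is the \<open>n\<close>-ary part of \<open>C\<close>.\<close>

definition local_clones :: "'a set \<Rightarrow> (nat \<times> ((nat \<Rightarrow> 'a) \<Rightarrow> 'a)) set set" where
  "local_clones X = {C. clone X C \<and> (\<forall>n\<ge>1. closedin (nary_ops_topology X n) (C `` {n}))}"

abbreviation Cl_loc :: "'a set \<Rightarrow> (nat \<times> ((nat \<Rightarrow> 'a) \<Rightarrow> 'a)) set gorder" where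
  "Cl_loc X \<equiv> inclusion_order (local_clones X)"


section \<open>Closed permutation groups and closed transformation monoids\<close>

definition maps_topology :: "'a set \<Rightarrow> ('a \<Rightarrow> 'a) topology" where
  "maps_topology X = product_topology (\<lambda>_. discrete_topology X) X"

definition local_groups :: "'a set \<Rightarrow> ('a \<Rightarrow> 'a) set set" where
  "local_groups X =
     {G. subgroup G (BijGroup X) \<and> closedin (subtopology (maps_topology X) (Bij X)) G}"

abbreviation Gr_loc :: "'a set \<Rightarrow> ('a \<Rightarrow> 'a) set gorder" where
  "Gr_loc X \<equiv> inclusion_order (local_groups X)"

definition transformation_monoid :: "'a set \<Rightarrow> ('a \<Rightarrow> 'a) set \<Rightarrow> bool" where
  "transformation_monoid X M \<longleftrightarrow>
     M \<subseteq> X \<rightarrow>\<^sub>E X \<and> (\<lambda>x\<in>X. x) \<in> M \<and> (\<forall>f\<in>M. \<forall>g\<in>M. compose X f g \<in> M)"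

definition local_monoids :: "'a set \<Rightarrow> ('a \<Rightarrow> 'a) set set" where
  "local_monoids X = {M. transformation_monoid X M \<and> closedin (maps_topology X) M}"

abbreviation Mon_loc :: "'a set \<Rightarrow> ('a \<Rightarrow> 'a) set gorder" where
  "Mon_loc X \<equiv> inclusion_order (local_monoids X)"

end

theory Submission
  imports Defs "HOL-Combinatorics.Transposition"
begin

text \<open>An algebraic lattice \<open>L\<close> is the lattice of closed sets of a finitary closure operator on the
  countable set \<open>K\<close> of its compact elements. The embedding into the three lattices of the theorem
  proceeds through equivalence relations and subgroups of a countable group.

  First, \<open>L\<close> is represented by equivalence relations on a countable set, in the manner of Whitman and
  Jonsson. The set carries a distance with finite subsets of \<open>K\<close> as values, and a closed set \<open>x\<close>
  is mapped to the relation \<open>distance \<subseteq> x\<close>. Intersections are then preserved for trivial reasons.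
  For joins, whenever the distance of \<open>a\<close> and \<open>b\<close> lies in the closure of \<open>P \<union> Q\<close>, a path of four
  edges with distances \<open>P\<close>, \<open>Q\<close>, \<open>P\<close>, \<open>Q\<close> from \<open>a\<close> to \<open>b\<close> is adjoined freely; countably many steps
  suffice. The crucial point is that the adjunction leaves the old distances unchanged and preserves
  the triangle inequality (\<open>sep_triangle\<close>); the paths yield compatibility with arbitrary joins of
  non-empty families (\<open>near_join\<close>), because distances are finite.

  Secondly, an equivalence relation \<open>E\<close> on a set \<open>A\<close> is mapped to the group of all finitary
  permutations of \<open>A\<close> that preserve each class of \<open>E\<close>. Intersections are preserved again, and joins
  are preserved because these groups are generated by transpositions (\<open>finitary_perms_join\<close>).

  Thirdly, the countable group of all finitary permutations of \<open>A\<close> acts on \<open>X\<close> by its regular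
  representation. All subgroups become closed sets of permutations, and even of maps, since a
  translation is known from one value. So a single map embeds \<open>L\<close> into the lattice of closed groups
  and into that of closed monoids (\<open>group_representation\<close>). Finally, a closed monoid is mapped to the
  local clone of the operations that depend on one argument through a member of the monoid.\<close>

section \<open>Complete sublattices of lattices of sets\<close>

lemma complete_lattice_inclusion_order:
  assumes top: "T \<in> F" "\<And>A. A \<in> F \<Longrightarrow> A \<subseteq> T"
    and Inter: "\<And>\<A>. \<A> \<subseteq> F \<Longrightarrow> \<A> \<noteq> {} \<Longrightarrow> \<Inter>\<A> \<in> F"
  shows "complete_lattice (inclusion_order F)"
proof -
  interpret partial_order "inclusion_order F"
    by unfold_locales auto
  show ?thesis
  proof (rule complete_lattice_criterion1)
    show "\<exists>g. greatest (inclusion_order F) g (carrier (inclusion_order F))"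
      using top by (intro exI[of _ T]) (auto simp: greatest_def)
    fix \<A> assume "\<A> \<subseteq> carrier (inclusion_order F)" "\<A> \<noteq> {}"
    then show "\<exists>i. greatest (inclusion_order F) i (Lower (inclusion_order F) \<A>)"
      using Inter[of \<A>] by (intro exI[of _ "\<Inter>\<A>"]) (auto simp: greatest_def Lower_def)
  qed
qed

text \<open>In a lattice of sets that is closed under intersection the meet is the intersection, so only
  the join has to be characterised: the image of a join must lie below every member of the
  lattice that contains the images of the joinands.\<close>

lemma iso_to_complete_sublatticeI:
  assumes L: "complete_lattice L"
    and top: "T \<in> F" "\<And>A. A \<in> F \<Longrightarrow> A \<subseteq> T"
    and Inter: "\<And>\<A>. \<A> \<subseteq> F \<Longrightarrow> \<A> \<noteq> {} \<Longrightarrow> \<Inter>\<A> \<in> F"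
    and h: "\<And>x. x \<in> carrier L \<Longrightarrow> h x \<in> F" "inj_on h (carrier L)"
    and inf: "\<And>A. A \<subseteq> carrier L \<Longrightarrow> A \<noteq> {} \<Longrightarrow> h (\<Sqinter>\<^bsub>L\<^esub>A) = (\<Inter>x\<in>A. h x)"
    and sup: "\<And>A B. A \<subseteq> carrier L \<Longrightarrow> A \<noteq> {} \<Longrightarrow> B \<in> F \<Longrightarrow> (\<And>x. x \<in> A \<Longrightarrow> h x \<subseteq> B) \<Longrightarrow> h (\<Squnion>\<^bsub>L\<^esub>A) \<subseteq> B"
  shows "iso_to_complete_sublattice L (inclusion_order F)"
proof -
  interpret L: complete_lattice L by (rule L)
  have M: "complete_lattice (inclusion_order F)"
    by (rule complete_lattice_inclusion_order[OF top Inter])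
  interpret M: complete_lattice "inclusion_order F" by (rule M)
  have mono: "h x \<subseteq> h y" if "x \<in> carrier L" "y \<in> carrier L" "x \<sqsubseteq>\<^bsub>L\<^esub> y" for x y
  proof -
    have "\<Sqinter>\<^bsub>L\<^esub>{x, y} = x"
      using that by (intro L.le_antisym L.inf_lower L.inf_greatest) auto
    then show ?thesis using inf[of "{x, y}"] that by auto
  qed
  have "h (\<Squnion>\<^bsub>L\<^esub>A) = \<Squnion>\<^bsub>inclusion_order F\<^esub>(h ` A)" if A: "A \<subseteq> carrier L" "A \<noteq> {}" for A
  proof (rule equalityI)
    have hA: "h ` A \<subseteq> carrier (inclusion_order F)" using A h by auto
    have "\<Squnion>\<^bsub>inclusion_order F\<^esub>(h ` A) \<in> F" using M.sup_closed[OF hA] by simp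
    moreover have "h x \<subseteq> \<Squnion>\<^bsub>inclusion_order F\<^esub>(h ` A)" if "x \<in> A" for x
      using M.sup_upper[OF hA, of "h x"] that by simp
    ultimately show "h (\<Squnion>\<^bsub>L\<^esub>A) \<subseteq> \<Squnion>\<^bsub>inclusion_order F\<^esub>(h ` A)"
      using sup A by blast
    have "h x \<subseteq> h (\<Squnion>\<^bsub>L\<^esub>A)" if "x \<in> A" for x
      using that A by (intro mono L.sup_upper) auto
    moreover have "h (\<Squnion>\<^bsub>L\<^esub>A) \<in> F" using h(1) A by simp
    ultimately show "\<Squnion>\<^bsub>inclusion_order F\<^esub>(h ` A) \<subseteq> h (\<Squnion>\<^bsub>L\<^esub>A)"
      using M.sup_least[OF hA, of "h (\<Squnion>\<^bsub>L\<^esub>A)"] by auto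
  qed
  moreover have "h (\<Sqinter>\<^bsub>L\<^esub>A) = \<Sqinter>\<^bsub>inclusion_order F\<^esub>(h ` A)" if A: "A \<subseteq> carrier L" "A \<noteq> {}" for A
  proof (rule equalityI)
    have hA: "h ` A \<subseteq> carrier (inclusion_order F)" using A h by auto
    have "h (\<Sqinter>\<^bsub>L\<^esub>A) \<subseteq> h x" if "x \<in> A" for x
      unfolding inf[OF A] using that by blast
    moreover have "h (\<Sqinter>\<^bsub>L\<^esub>A) \<in> F" using h(1) A by simp
    ultimately show "h (\<Sqinter>\<^bsub>L\<^esub>A) \<subseteq> \<Sqinter>\<^bsub>inclusion_order F\<^esub>(h ` A)"
      using M.inf_greatest[OF hA, of "h (\<Sqinter>\<^bsub>L\<^esub>A)"] by auto
    have "\<Sqinter>\<^bsub>inclusion_order F\<^esub>(h ` A) \<subseteq> h x" if "x \<in> A" for x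
      using M.inf_lower[OF hA, of "h x"] that by simp
    then show "\<Sqinter>\<^bsub>inclusion_order F\<^esub>(h ` A) \<subseteq> h (\<Sqinter>\<^bsub>L\<^esub>A)"
      unfolding inf[OF A] by blast
  qed
  ultimately show ?thesis
    using h L M unfolding iso_to_complete_sublattice_def weak_sup_pres_def weak_inf_pres_def
    by (intro bexI[of _ h]) auto
qed


section \<open>Equivalence relations from a finitary closure operator\<close>

text \<open>An algebraic lattice is the lattice of closed sets of a finitary closure operator on its
  compact elements. The closure operator is all that the construction below refers to; joins of
  compact elements are replaced by finite sets of them.\<close>

locale finitary_closure =
  fixes K :: "'k set" and cl :: "'k set \<Rightarrow> 'k set"
  assumes cl_extensive: "C \<subseteq> K \<Longrightarrow> C \<subseteq> cl C"
    and cl_least: "C \<subseteq> K \<Longrightarrow> D \<subseteq> K \<Longrightarrow> C \<subseteq> cl D \<Longrightarrow> cl C \<subseteq> cl D"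
    and cl_finitary: "C \<subseteq> K \<Longrightarrow> c \<in> cl C \<Longrightarrow> \<exists>B\<subseteq>C. finite B \<and> c \<in> cl B"
begin

definition closed_set :: "'k set \<Rightarrow> bool" where
  "closed_set x \<longleftrightarrow> x \<subseteq> K \<and> cl x = x"

lemma cl_mono: "C \<subseteq> D \<Longrightarrow> D \<subseteq> K \<Longrightarrow> cl C \<subseteq> cl D"
  using cl_extensive[of D] by (intro cl_least) auto

lemma cl_subset_closed: "closed_set x \<Longrightarrow> C \<subseteq> x \<Longrightarrow> cl C \<subseteq> x"
  using cl_mono[of C x] by (auto simp: closed_set_def)

lemma finite_subset_cl:
  assumes "finite F" "F \<subseteq> cl C" "C \<subseteq> K"
  shows "\<exists>B\<subseteq>C. finite B \<and> F \<subseteq> cl B"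
  using assms(1,2)
proof (induction F)
  case empty
  then show ?case by blast
next
  case (insert c F)
  then obtain B where B: "B \<subseteq> C" "finite B" "F \<subseteq> cl B" by auto
  obtain B' where B': "B' \<subseteq> C" "finite B'" "c \<in> cl B'"
    using cl_finitary[OF assms(3), of c] insert.prems by auto
  have "B \<union> B' \<subseteq> K"
    using B B' assms(3) by auto
  then have "cl B \<subseteq> cl (B \<union> B')" "cl B' \<subseteq> cl (B \<union> B')"
    by (auto intro: cl_mono[THEN subsetD, rotated 2])
  then show ?case
    using B B' by (intro exI[of _ "B \<union> B'"]) auto
qed

end

text \<open>The points of the space to be built are generated freely. Given points \<open>a\<close>, \<open>b\<close> and finite
  sets \<open>P\<close>, \<open>Q\<close>, three new points are inserted between \<open>a\<close> and \<open>b\<close>, giving the path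
  \<open>a \<midarrow>P\<midarrow> First \<midarrow>Q\<midarrow> Second \<midarrow>P\<midarrow> Third \<midarrow>Q\<midarrow> b\<close>, where the label of an edge is the distance of its
  ends. Three inner points are what a lattice that is not modular requires. The number in
  \<open>New\<close> is the stage of the construction; it tells new points from old ones, and it makes the
  same path be inserted again at every later stage.\<close>

datatype corner = First | Second | Third

datatype 'k point = Origin | New nat corner "'k point" "'k point" "'k set" "'k set"

text \<open>Seen from outside its own path, a new point is reached through an old point, its anchor, at
  a fixed cost. For \<open>Second\<close> either end of the path could serve, since the two ends will satisfy
  \<open>sep n a b \<subseteq> cl (P \<union> Q)\<close> and the cost is \<open>P \<union> Q\<close>. Points older than stage \<open>n\<close> anchor themselves
  at no cost.\<close>

fun anchor :: "nat \<Rightarrow> 'k point \<Rightarrow> 'k point" where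
  "anchor n Origin = Origin"
| "anchor n (New m i a b P Q) =
     (if m < n then New m i a b P Q else case i of First \<Rightarrow> a | Second \<Rightarrow> a | Third \<Rightarrow> b)"

fun cost :: "nat \<Rightarrow> 'k point \<Rightarrow> 'k set" where
  "cost n Origin = {}"
| "cost n (New m i a b P Q) =
     (if m < n then {} else case i of First \<Rightarrow> P | Second \<Rightarrow> P \<union> Q | Third \<Rightarrow> Q)"

text \<open>The two inner edges of a path, \<open>First\<close>--\<open>Second\<close> and \<open>Second\<close>--\<open>Third\<close>, are the only pairs of
  distinct points for which the way through the anchors is too long up to closure.\<close>

fun edge :: "nat \<Rightarrow> 'k point \<Rightarrow> 'k point \<Rightarrow> 'k set option" where
  "edge n (New m i a b P Q) (New m' i' a' b' P' Q') =
     (if m = n \<and> m' = n \<and> a = a' \<and> b = b' \<and> P = P' \<and> Q = Q' then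
        (case (i, i') of
           (First, Second) \<Rightarrow> Some Q | (Second, First) \<Rightarrow> Some Q
         | (Second, Third) \<Rightarrow> Some P | (Third, Second) \<Rightarrow> Some P
         | _ \<Rightarrow> None)
      else None)"
| "edge n _ _ = None"

text \<open>A metric with finite sets of labels as values and union in the place of addition: two points
  are to be identified by a closed set \<open>x\<close> iff their distance is contained in \<open>x\<close>.\<close>

primrec sep :: "nat \<Rightarrow> 'k point \<Rightarrow> 'k point \<Rightarrow> 'k set" where
  "sep 0 u v = {}"
| "sep (Suc n) u v =
     (if u = v then {} else
      case edge n u v of
        Some l \<Rightarrow> l
      | None \<Rightarrow> cost n u \<union> sep n (anchor n u) (anchor n v) \<union> cost n v)"

lemma edge_cases:
  assumes "edge n u v = Some l"
  obtains a b P Q where "u = New n First a b P Q" "v = New n Second a b P Q" "l = Q"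
  | a b P Q where "u = New n Second a b P Q" "v = New n First a b P Q" "l = Q"
  | a b P Q where "u = New n Second a b P Q" "v = New n Third a b P Q" "l = P"
  | a b P Q where "u = New n Third a b P Q" "v = New n Second a b P Q" "l = P"
  using assms
  by (cases "(n, u, v)" rule: edge.cases) (auto split: corner.splits if_splits)

lemma edge_sym: "edge n u v = edge n v u"
  by (cases "(n, u, v)" rule: edge.cases) (auto split: corner.splits)

lemma sep_self [simp]: "sep n u u = {}"
  by (cases n) auto

lemma sep_sym: "sep n u v = sep n v u"
  by (induction n arbitrary: u v) (auto simp: edge_sym split: option.splits)

context finitary_closure
begin

text \<open>A path with labels \<open>P\<close> and \<open>Q\<close> may be inserted only where it is no shortcut, that is, where
  every closed set that contains both labels already identifies the end points.\<close>

primrec points :: "nat \<Rightarrow> 'k point set" where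
  "points 0 = {Origin}"
| "points (Suc n) = points n \<union>
     {New n i a b P Q | i a b P Q. a \<in> points n \<and> b \<in> points n \<and>
        finite P \<and> P \<subseteq> K \<and> finite Q \<and> Q \<subseteq> K \<and> sep n a b \<subseteq> cl (P \<union> Q)}"

lemma New_in_points_less: "New m i a b P Q \<in> points n \<Longrightarrow> m < n"
  by (induction n) (auto simp: less_Suc_eq)

lemma old_point:
  assumes "u \<in> points n"
  shows "anchor n u = u" "cost n u = {}" "edge n u v = None" "edge n v u = None"
proof -
  have "u = Origin \<or> (\<exists>m i a b P Q. u = New m i a b P Q \<and> m < n)"
    using assms New_in_points_less by (cases u) auto
  then show "anchor n u = u" "cost n u = {}" "edge n u v = None" "edge n v u = None"
    by (cases v; force)+
qed

lemma anchor_in_points: "u \<in> points (Suc n) \<Longrightarrow> anchor n u \<in> points n"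
  by (auto simp: old_point split: corner.splits)

lemma finite_cost: "u \<in> points (Suc n) \<Longrightarrow> finite (cost n u)"
  by (auto simp: old_point split: corner.splits)

lemma points_mono: "m \<le> n \<Longrightarrow> points m \<subseteq> points n"
  by (rule lift_Suc_mono_le[of points]) auto

lemma sep_stable:
  assumes "u \<in> points m" "v \<in> points m" "m \<le> n"
  shows "sep n u v = sep m u v"
  using assms(3)
proof (induction n rule: dec_induct)
  case (step n)
  have "u \<in> points n" "v \<in> points n"
    using assms points_mono[OF step.hyps(1)] by auto
  with step.IH show ?case by (auto simp: old_point)
qed simp

lemma finite_sep: "u \<in> points n \<Longrightarrow> v \<in> points n \<Longrightarrow> finite (sep n u v)"
proof (induction n arbitrary: u v)
  case (Suc n)
  have "finite l" if "edge n u v = Some l" for l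
    using that Suc.prems by (cases rule: edge_cases) (auto dest: old_point(3)[where v=v])
  then show ?case
    using Suc by (auto simp: anchor_in_points finite_cost split: option.splits simp del: points.simps)
qed simp

text \<open>The triangle inequality modulo closure. Distances through the anchors inherit it from the
  previous stage. An inner edge can be exchanged for a way through the anchors because the label
  of the edge together with the cost of either end covers the cost of the other; where the two
  ends have different anchors \<open>a\<close> and \<open>b\<close>, the condition \<open>sep n a b \<subseteq> cl (P \<union> Q)\<close> on the path
  enters.\<close>

lemma sep_triangle:
  assumes x: "closed_set x"
  shows "u \<in> points n \<Longrightarrow> v \<in> points n \<Longrightarrow> w \<in> points n \<Longrightarrow>
    sep n u v \<subseteq> x \<Longrightarrow> sep n v w \<subseteq> x \<Longrightarrow> sep n u w \<subseteq> x"
proof (induction n arbitrary: u v w)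
  case (Suc n)
  define via where "via u v = cost n u \<union> sep n (anchor n u) (anchor n v) \<union> cost n v" for u v :: "'k point"
  have via_sym: "via u v = via v u" for u v
    by (auto simp: via_def sep_sym)
  have sep_le_via: "sep (Suc n) u v \<subseteq> via u v" for u v
  proof (cases "edge n u v")
    case None
    then show ?thesis by (auto simp: via_def)
  next
    case (Some l)
    then show ?thesis by (cases rule: edge_cases) (auto simp: via_def)
  qed
  have via_triangle: "via u w \<subseteq> x"
    if "u \<in> points (Suc n)" "v \<in> points (Suc n)" "w \<in> points (Suc n)" "via u v \<subseteq> x" "via v w \<subseteq> x" for u v w
    using that Suc.IH[of "anchor n u" "anchor n v" "anchor n w"]
    unfolding via_def by (auto simp del: points.simps dest: anchor_in_points)
  have cell: "sep n a b \<subseteq> x" "a \<in> points n" "b \<in> points n"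
    if "New n i a b P Q \<in> points (Suc n)" "P \<subseteq> x" "Q \<subseteq> x" for i a b P Q
  proof -
    have "New n i a b P Q \<notin> points n"
      using New_in_points_less by blast
    with that(1) have *: "a \<in> points n" "b \<in> points n" "sep n a b \<subseteq> cl (P \<union> Q)"
      by auto
    moreover have "cl (P \<union> Q) \<subseteq> x"
      using that x by (intro cl_subset_closed) auto
    ultimately show "sep n a b \<subseteq> x" "a \<in> points n" "b \<in> points n" by auto
  qed
  \<comment> \<open>an inner edge followed by a way through the anchors\<close>
  have edge_via: "via u w \<subseteq> x"
    if "edge n u v = Some l" "l \<subseteq> x" "via v w \<subseteq> x"
      and uvw: "u \<in> points (Suc n)" "v \<in> points (Suc n)" "w \<in> points (Suc n)" for u v w l
    using that(1)
  proof (cases rule: edge_cases)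
    case (1 a b P Q)
    then show ?thesis using that by (auto simp: via_def)
  next
    case (2 a b P Q)
    then show ?thesis using that by (auto simp: via_def)
  next
    case (3 a b P Q)
    have PQ: "P \<subseteq> x" "Q \<subseteq> x" "sep n b (anchor n w) \<subseteq> x" using that 3 by (auto simp: via_def)
    have "sep n a (anchor n w) \<subseteq> x"
      using Suc.IH[of a b "anchor n w"] cell[of Second a b P Q] uvw PQ 3 anchor_in_points by blast
    then show ?thesis using that 3 PQ by (auto simp: via_def)
  next
    case (4 a b P Q)
    have PQ: "P \<subseteq> x" "Q \<subseteq> x" "sep n a (anchor n w) \<subseteq> x" using that 4 by (auto simp: via_def)
    have "sep n b (anchor n w) \<subseteq> x"
      using Suc.IH[of b a "anchor n w"] cell[of Second a b P Q] uvw PQ 4 anchor_in_points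
      by (metis sep_sym)
    then show ?thesis using that 4 PQ by (auto simp: via_def)
  qed
  have sep_cases: "u = v \<or> (\<exists>l. edge n u v = Some l \<and> l \<subseteq> x) \<or> via u v \<subseteq> x"
    if "sep (Suc n) u v \<subseteq> x" for u v
    using that by (auto simp: via_def split: if_splits option.splits)
  \<comment> \<open>two inner edges in succession lead back to the start or along the whole path\<close>
  have edge_edge: "u = w \<or> via u w \<subseteq> x"
    if e: "edge n u v = Some l" "edge n v w = Some l'" and l: "l \<subseteq> x" "l' \<subseteq> x"
      and uvw: "u \<in> points (Suc n)" for u v w l l'
    using e(1)
  proof (cases rule: edge_cases)
    case (1 a b P Q)
    with e(2) l have "u = w \<or> w = New n Third a b P Q \<and> P \<subseteq> x \<and> Q \<subseteq> x"
      by (cases w) (auto split: corner.splits if_splits)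
    with 1 cell[of First a b P Q] uvw show ?thesis by (auto simp: via_def simp del: points.simps)
  next
    case (2 a b P Q)
    with e(2) show ?thesis
      by (cases w) (auto split: corner.splits if_splits)
  next
    case (3 a b P Q)
    with e(2) show ?thesis
      by (cases w) (auto split: corner.splits if_splits)
  next
    case (4 a b P Q)
    with e(2) l have "u = w \<or> w = New n First a b P Q \<and> P \<subseteq> x \<and> Q \<subseteq> x"
      by (cases w) (auto split: corner.splits if_splits)
    with 4 cell[of Third a b P Q] uvw show ?thesis by (auto simp: via_def sep_sym[of n b a] simp del: points.simps)
  qed
  have "u = w \<or> via u w \<subseteq> x \<or> sep (Suc n) u w \<subseteq> x"
    using sep_cases[OF Suc.prems(4)] sep_cases[OF Suc.prems(5)]
  proof (elim disjE exE conjE)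
    fix l l' assume "edge n u v = Some l" "l \<subseteq> x" "edge n v w = Some l'" "l' \<subseteq> x"
    then show ?thesis using edge_edge Suc.prems by blast
  next
    fix l assume "edge n u v = Some l" "l \<subseteq> x" "via v w \<subseteq> x"
    then show ?thesis using edge_via Suc.prems by blast
  next
    fix l assume "edge n v w = Some l" "l \<subseteq> x" "via u v \<subseteq> x"
    then have "via w u \<subseteq> x" using edge_via[of w v l u] Suc.prems by (simp add: edge_sym via_sym del: points.simps)
    then show ?thesis by (simp add: via_sym)
  next
    assume "via u v \<subseteq> x" "via v w \<subseteq> x"
    then show ?thesis using via_triangle Suc.prems by blast
  qed (use Suc.prems in blast)+
  then show ?case using sep_le_via[of u w] by auto
qed simp

text \<open>For closed \<open>x\<close> this is an equivalence relation on the set of all points. By stability of the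
  distance it does not matter at which stage two points are compared.\<close>

definition near :: "'k set \<Rightarrow> ('k point \<times> 'k point) set" where
  "near x = {(u, v). \<exists>n. u \<in> points n \<and> v \<in> points n \<and> sep n u v \<subseteq> x}"

lemma nearI: "u \<in> points n \<Longrightarrow> v \<in> points n \<Longrightarrow> sep n u v \<subseteq> x \<Longrightarrow> (u, v) \<in> near x"
  by (auto simp: near_def)

lemma near_iff: "u \<in> points n \<Longrightarrow> v \<in> points n \<Longrightarrow> (u, v) \<in> near x \<longleftrightarrow> sep n u v \<subseteq> x"
proof -
  assume uv: "u \<in> points n" "v \<in> points n"
  have "sep m u v = sep n u v" if "u \<in> points m" "v \<in> points m" for m
    using nat_le_linear[of m n]
    by (elim disjE) (rule sep_stable[OF that, symmetric] sep_stable[OF uv], assumption)+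
  then show ?thesis unfolding near_def using uv by blast
qed

lemma common_level:
  assumes "u \<in> (\<Union>n. points n)" "v \<in> (\<Union>n. points n)"
  obtains n where "u \<in> points n" "v \<in> points n"
proof -
  obtain m n where "u \<in> points m" "v \<in> points n" using assms by auto
  then have "u \<in> points (max m n)" "v \<in> points (max m n)"
    using points_mono[of m "max m n"] points_mono[of n "max m n"] by auto
  then show ?thesis using that by blast
qed

lemma near_subset: "near x \<subseteq> (\<Union>n. points n) \<times> (\<Union>n. points n)"
  by (auto simp: near_def)

lemma near_mono: "x \<subseteq> y \<Longrightarrow> near x \<subseteq> near y"
  by (auto simp: near_def)

lemma near_refl: "a \<in> (\<Union>n. points n) \<Longrightarrow> (a, a) \<in> near x"
  by (auto intro: nearI)

lemma sym_near: "sym (near x)"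
  by (auto simp: sym_def near_def sep_sym)

lemma trans_near:
  assumes "closed_set x" shows "trans (near x)"
proof (rule transI)
  fix u v w assume *: "(u, v) \<in> near x" "(v, w) \<in> near x"
  then have "u \<in> (\<Union>n. points n)" "v \<in> (\<Union>n. points n)" "w \<in> (\<Union>n. points n)"
    using near_subset by auto
  then obtain l m where "u \<in> points l" "v \<in> points l" "v \<in> points m" "w \<in> points m"
    by (meson common_level)
  then have n: "u \<in> points (max l m)" "v \<in> points (max l m)" "w \<in> points (max l m)"
    using points_mono[of l "max l m"] points_mono[of m "max l m"] by auto
  show "(u, w) \<in> near x"
    using sep_triangle[OF assms n] * unfolding near_iff[OF n(1,2)] near_iff[OF n(2,3)] near_iff[OF n(1,3)]
    by blast
qed

lemma near_Inter:
  assumes "\<A> \<noteq> {}"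
  shows "near (\<Inter>\<A>) = \<Inter>(near ` \<A>)"
proof (intro equalityI subrelI)
  fix u v assume uv: "(u, v) \<in> \<Inter>(near ` \<A>)"
  obtain x where "x \<in> \<A>" using assms by blast
  with uv have "(u, v) \<in> near x" by blast
  then obtain n where n: "u \<in> points n" "v \<in> points n"
    by (auto simp: near_def)
  with uv have "\<forall>x\<in>\<A>. sep n u v \<subseteq> x" by (simp add: near_iff)
  with n show "(u, v) \<in> near (\<Inter>\<A>)" by (auto simp: near_iff)
qed (auto simp: near_def)

text \<open>This is what the paths are for. Since distances are finite and the closure is finitary, the
  distance of \<open>u\<close> and \<open>v\<close> lies in the closure of finitely many labels, each taken from one of the
  given sets. One label \<open>c\<close> can be split off: a path with labels \<open>{c}\<close> and \<open>C\<close> between \<open>u\<close> and \<open>v\<close>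
  has been inserted, and its edges are near with respect to \<open>{c}\<close> or to \<open>cl C\<close>. Induction over the
  finite set of labels finishes the argument. The family has to be non-empty because paths with
  empty labels make distinct points near with respect to \<open>cl {}\<close>.\<close>

lemma near_join:
  assumes "\<A> \<noteq> {}" and closed: "\<And>x. x \<in> \<A> \<Longrightarrow> closed_set x"
  shows "near (cl (\<Union>\<A>)) \<subseteq> (\<Union>(near ` \<A>))\<^sup>*"
proof (rule subrelI)
  have AK: "\<Union>\<A> \<subseteq> K" using closed by (auto simp: closed_set_def)
  have step: "(u, v) \<in> near (cl C) \<Longrightarrow> (u, v) \<in> (\<Union>(near ` \<A>))\<^sup>*"
    if "finite C" "C \<subseteq> \<Union>\<A>" for C u v
    using that
  proof (induction C arbitrary: u v)
    case empty
    obtain x where "x \<in> \<A>" using assms by auto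
    then have "cl {} \<subseteq> x" using closed cl_subset_closed by auto
    with empty near_mono[of "cl {}" x] \<open>x \<in> \<A>\<close> show ?case by blast
  next
    case (insert c C)
    obtain x where x: "x \<in> \<A>" "c \<in> x" using insert.prems by auto
    obtain n where n: "u \<in> points n" "v \<in> points n" "sep n u v \<subseteq> cl (insert c C)"
      using insert.prems by (auto simp: near_def)
    define z where "z i = New n i u v {c} C" for i
    have CK: "C \<subseteq> K" "c \<in> K" using insert.prems AK by auto
    have z: "z i \<in> points (Suc n)" for i
      using n insert.hyps CK by (auto simp: z_def)
    have uv: "u \<in> points (Suc n)" "v \<in> points (Suc n)" using n by auto
    have C: "C \<subseteq> cl C" using CK cl_extensive by auto
    have "sep (Suc n) u (z First) \<subseteq> x" "sep (Suc n) (z Second) (z Third) \<subseteq> x"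
      "sep (Suc n) (z First) (z Second) \<subseteq> cl C" "sep (Suc n) (z Third) v \<subseteq> cl C"
      using n(1,2) x C by (auto simp: old_point z_def)
    then have "(u, z First) \<in> near x" "(z Second, z Third) \<in> near x"
      and q: "(z First, z Second) \<in> near (cl C)" "(z Third, v) \<in> near (cl C)"
      using z uv by (blast intro: nearI)+
    then have p: "(u, z First) \<in> \<Union>(near ` \<A>)" "(z Second, z Third) \<in> \<Union>(near ` \<A>)"
      using x by auto
    from q have "(z First, z Second) \<in> (\<Union>(near ` \<A>))\<^sup>*" "(z Third, v) \<in> (\<Union>(near ` \<A>))\<^sup>*"
      using insert.IH insert.prems by auto
    with p show ?case
      by (meson rtrancl_trans r_into_rtrancl)
  qed
  fix u v assume "(u, v) \<in> near (cl (\<Union>\<A>))"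
  then obtain n where n: "u \<in> points n" "v \<in> points n" "sep n u v \<subseteq> cl (\<Union>\<A>)"
    by (auto simp: near_def)
  obtain C where "C \<subseteq> \<Union>\<A>" "finite C" "sep n u v \<subseteq> cl C"
    using finite_subset_cl[OF finite_sep[OF n(1,2)] n(3) AK] by auto
  with step n show "(u, v) \<in> (\<Union>(near ` \<A>))\<^sup>*" by (blast intro: nearI)
qed

text \<open>Every label occurs as a distance, namely on a path from the origin back to itself.\<close>

lemma near_reflects:
  assumes "x \<subseteq> K" "near x \<subseteq> near y"
  shows "x \<subseteq> y"
proof
  fix c assume "c \<in> x"
  define u where "u = New 0 First Origin Origin {c} {}"
  have pts: "Origin \<in> points (Suc 0)" "u \<in> points (Suc 0)"
    using \<open>c \<in> x\<close> assms(1) by (auto simp: u_def)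
  have sep: "sep (Suc 0) Origin u = {c}" by (simp add: u_def)
  have "(Origin, u) \<in> near x"
    using \<open>c \<in> x\<close> sep by (intro nearI[OF pts]) simp
  with assms(2) have "(Origin, u) \<in> near y" by (rule subsetD)
  then have "sep (Suc 0) Origin u \<subseteq> y" by (rule near_iff[OF pts, THEN iffD1])
  then show "c \<in> y" by (simp only: sep insert_subset)
qed

text \<open>Paths with empty labels around the origin are inserted at each stage.\<close>

lemma infinite_points: "infinite (\<Union>n. points n)"
proof -
  have o: "Origin \<in> points n" for n by (induction n) auto
  define f :: "nat \<Rightarrow> 'k point" where "f = (\<lambda>n. New n First Origin Origin {} {})"
  have "f n \<in> points (Suc n)" for n using o[of n] by (simp add: f_def)
  then have "f n \<in> (\<Union>n. points n)" for n by (intro UN_I[of "Suc n"]) simp_all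
  then have "range f \<subseteq> (\<Union>n. points n)" by (intro subsetI) (elim rangeE, simp only:)
  moreover have "infinite (range f)" by (intro range_inj_infinite injI) (simp add: f_def)
  ultimately show ?thesis using infinite_super by blast
qed

lemma countable_points:
  assumes "countable K"
  shows "countable (\<Union>n. points n)"
proof -
  have "countable (points n)" for n
  proof (induction n)
    case (Suc n)
    let ?F = "{P. finite P \<and> P \<subseteq> K}"
    have F: "countable ?F" using countable_Collect_finite_subset[OF assms] by (simp add: conj_commute)
    have "countable (UNIV :: corner set)"
    proof (rule countable_subset)
      show "(UNIV :: corner set) \<subseteq> {First, Second, Third}"
        by (intro subsetI) (metis corner.exhaust insertCI)
    qed simp
    then have "countable (UNIV \<times> points n \<times> points n \<times> ?F \<times> ?F :: (corner \<times> _) set)"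
      using Suc.IH F by (intro countable_SIGMA)
    moreover have "points (Suc n) \<subseteq> points n \<union> (\<lambda>(i, a, b, P, Q). New n i a b P Q) `
        (UNIV \<times> points n \<times> points n \<times> ?F \<times> ?F)"
    proof
      fix p assume "p \<in> points (Suc n)"
      then consider "p \<in> points n"
        | i a b P Q where "p = New n i a b P Q" "a \<in> points n" "b \<in> points n" "P \<in> ?F" "Q \<in> ?F"
        by auto
      then show "p \<in> points n \<union> (\<lambda>(i, a, b, P, Q). New n i a b P Q) `
        (UNIV \<times> points n \<times> points n \<times> ?F \<times> ?F)"
      proof cases
        case 2
        then show ?thesis by (intro UnI2 image_eqI[of _ _ "(i, a, b, P, Q)"]) auto
      qed simp
    qed
    ultimately show ?case
      using Suc.IH by (meson countable_Un countable_image countable_subset)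
  qed simp
  then show ?thesis by auto
qed

end


section \<open>Finitary permutations preserving an equivalence relation\<close>

text \<open>For an equivalence relation \<open>E\<close>, these are the permutations with finite support that map each
  class of \<open>E\<close> onto itself. Points outside the field of \<open>E\<close> are fixed.\<close>

definition finitary_perms :: "('p \<times> 'p) set \<Rightarrow> ('p \<Rightarrow> 'p) set" where
  "finitary_perms E = {\<sigma>. bij \<sigma> \<and> finite {a. \<sigma> a \<noteq> a} \<and> (\<forall>a. \<sigma> a \<noteq> a \<longrightarrow> (a, \<sigma> a) \<in> E)}"

lemma finitary_perms_id: "id \<in> finitary_perms E"
  by (simp add: finitary_perms_def)

lemma finitary_perms_comp:
  assumes "trans E" "\<sigma> \<in> finitary_perms E" "\<tau> \<in> finitary_perms E"
  shows "\<sigma> \<circ> \<tau> \<in> finitary_perms E"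
proof -
  have "{a. (\<sigma> \<circ> \<tau>) a \<noteq> a} \<subseteq> {a. \<sigma> a \<noteq> a} \<union> {a. \<tau> a \<noteq> a}" by auto
  then have "finite {a. (\<sigma> \<circ> \<tau>) a \<noteq> a}"
    using assms unfolding finitary_perms_def by (auto intro: finite_subset)
  moreover have "(a, (\<sigma> \<circ> \<tau>) a) \<in> E" if "(\<sigma> \<circ> \<tau>) a \<noteq> a" for a
  proof -
    have "\<tau> a = a \<or> (a, \<tau> a) \<in> E" "\<sigma> (\<tau> a) = \<tau> a \<or> (\<tau> a, \<sigma> (\<tau> a)) \<in> E"
      using assms by (auto simp: finitary_perms_def)
    then show ?thesis using that transD[OF assms(1)] by (auto simp: o_def)
  qed
  ultimately show ?thesis
    using assms bij_comp[of \<tau> \<sigma>] by (auto simp: finitary_perms_def)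
qed

lemma finitary_perms_inv:
  assumes "sym E" "\<sigma> \<in> finitary_perms E"
  shows "inv_into UNIV \<sigma> \<in> finitary_perms E"
proof -
  have b: "bij \<sigma>" using assms by (simp add: finitary_perms_def)
  then have *: "inv_into UNIV \<sigma> a \<noteq> a \<longleftrightarrow> \<sigma> a \<noteq> a" for a
    by (metis bij_inv_eq_iff)
  moreover have "(a, inv_into UNIV \<sigma> a) \<in> E" if "\<sigma> a \<noteq> a" for a
  proof -
    have "\<sigma> (inv_into UNIV \<sigma> a) = a" using b by (simp add: bij_is_surj surj_f_inv_f)
    then have "(inv_into UNIV \<sigma> a, a) \<in> E"
      using assms that by (auto simp: finitary_perms_def) (metis (mono_tags))
    then show ?thesis using assms(1) by (rule symD[rotated])
  qed
  ultimately show ?thesis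
    using assms b by (auto simp: finitary_perms_def bij_imp_bij_inv)
qed

lemma finitary_perms_mono: "E \<subseteq> F \<Longrightarrow> finitary_perms E \<subseteq> finitary_perms F"
  by (auto simp: finitary_perms_def)

lemma finitary_perms_Inter:
  "I \<noteq> {} \<Longrightarrow> finitary_perms (\<Inter>i\<in>I. E i) = (\<Inter>i\<in>I. finitary_perms (E i))"
  by (auto simp: finitary_perms_def)

lemma transpose_in_finitary_perms:
  assumes "sym E" "(a, b) \<in> E"
  shows "Transposition.transpose a b \<in> finitary_perms E"
proof -
  have "{c. Transposition.transpose a b c \<noteq> c} \<subseteq> {a, b}"
    by (auto simp: Transposition.transpose_def)
  then have "finite {c. Transposition.transpose a b c \<noteq> c}" by (rule finite_subset) simp
  then show ?thesis
    using assms by (auto simp: finitary_perms_def Transposition.transpose_def dest: symD)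
qed

lemma finitary_perms_transpose_iff:
  assumes "sym E" "a \<noteq> b"
  shows "Transposition.transpose a b \<in> finitary_perms E \<longleftrightarrow> (a, b) \<in> E"
proof
  assume "Transposition.transpose a b \<in> finitary_perms E"
  then have "Transposition.transpose a b a \<noteq> a \<longrightarrow> (a, Transposition.transpose a b a) \<in> E"
    unfolding finitary_perms_def by blast
  then show "(a, b) \<in> E" using assms(2) by simp
qed (rule transpose_in_finitary_perms[OF assms(1)])

text \<open>The relation can be read off from the transpositions in the group, up to its diagonal.\<close>

lemma finitary_perms_reflects:
  assumes "sym E" "sym F" "\<And>a. (a, a) \<in> E \<Longrightarrow> (a, a) \<in> F" "finitary_perms E \<subseteq> finitary_perms F"
  shows "E \<subseteq> F"
proof (rule subrelI)
  fix a b assume ab: "(a, b) \<in> E"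
  show "(a, b) \<in> F"
  proof (cases "a = b")
    case False
    then show ?thesis
      using transpose_in_finitary_perms[OF assms(1) ab] assms(4) finitary_perms_transpose_iff[OF assms(2) False]
      by blast
  qed (use ab assms(3) in blast)
qed

lemma finitary_perms_generated:
  assumes "sym E" "trans E" "id \<in> S"
    and comp: "\<And>\<sigma> \<tau>. \<sigma> \<in> S \<Longrightarrow> \<tau> \<in> S \<Longrightarrow> \<sigma> \<circ> \<tau> \<in> S"
    and transpose: "\<And>a b. (a, b) \<in> E \<Longrightarrow> Transposition.transpose a b \<in> S"
  shows "finitary_perms E \<subseteq> S"
proof
  fix \<sigma> assume "\<sigma> \<in> finitary_perms E"
  then show "\<sigma> \<in> S"
  proof (induction "card {a. \<sigma> a \<noteq> a}" arbitrary: \<sigma> rule: less_induct)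
    case less
    show ?case
    proof (cases "\<exists>a. \<sigma> a \<noteq> a")
      case False
      then have "\<sigma> = id" by auto
      with assms(3) show ?thesis by simp
    next
      case True
      then obtain a where a: "\<sigma> a \<noteq> a" by blast
      define t where "t = Transposition.transpose a (\<sigma> a)"
      have aE: "(a, \<sigma> a) \<in> E" using a less.prems by (simp add: finitary_perms_def)
      have inj: "\<sigma> x = \<sigma> y \<Longrightarrow> x = y" for x y
        using less.prems by (auto simp: finitary_perms_def bij_def inj_def)
      \<comment> \<open>composing with the transposition of a and its image fixes a and moves no new point\<close>
      have "{c. (t \<circ> \<sigma>) c \<noteq> c} \<subseteq> {c. \<sigma> c \<noteq> c} - {a}"
      proof
        fix c assume c: "c \<in> {c. (t \<circ> \<sigma>) c \<noteq> c}"
        have "(t \<circ> \<sigma>) a = a" by (simp add: t_def)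
        moreover have "(t \<circ> \<sigma>) c = c" if "\<sigma> c = c" "c \<noteq> a"
          using that inj[of c a] by (cases "c = \<sigma> a") (simp_all add: t_def)
        ultimately show "c \<in> {c. \<sigma> c \<noteq> c} - {a}" using c a by (cases "c = a") auto
      qed
      then have sub: "{c. (t \<circ> \<sigma>) c \<noteq> c} \<subset> {c. \<sigma> c \<noteq> c}" using a by blast
      have fin: "finite {c. \<sigma> c \<noteq> c}" using less.prems by (simp add: finitary_perms_def)
      have "t \<circ> \<sigma> \<in> finitary_perms E"
        unfolding t_def using aE less.prems assms(1,2)
        by (intro finitary_perms_comp transpose_in_finitary_perms)
      then have "t \<circ> \<sigma> \<in> S" using less.hyps psubset_card_mono[OF fin sub] by blast
      moreover have "t \<in> S" using transpose aE by (simp add: t_def)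
      ultimately have "t \<circ> (t \<circ> \<sigma>) \<in> S" by (rule comp[rotated])
      then show ?thesis by (simp add: t_def o_assoc)
    qed
  qed
qed

text \<open>If \<open>a\<close> and \<open>c\<close> are joined by a chain of steps within the given relations, conjugation along
  the chain turns the transpositions of the steps into the transposition of \<open>a\<close> and \<open>c\<close>.
  Transpositions are involutions, so all this happens within any monoid \<open>S\<close> that contains the
  groups; this is why the joins of groups, of monoids and of clones can be treated alike.\<close>

lemma finitary_perms_join:
  assumes E: "sym E" "trans E" "E \<subseteq> (\<Union>i\<in>I. E' i)\<^sup>*" and E': "\<And>i. i \<in> I \<Longrightarrow> sym (E' i)"
    and "id \<in> S" and comp: "\<And>\<sigma> \<tau>. \<sigma> \<in> S \<Longrightarrow> \<tau> \<in> S \<Longrightarrow> \<sigma> \<circ> \<tau> \<in> S"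
    and sub: "\<And>i. i \<in> I \<Longrightarrow> finitary_perms (E' i) \<subseteq> S"
  shows "finitary_perms E \<subseteq> S"
proof (rule finitary_perms_generated[OF E(1,2) \<open>id \<in> S\<close> comp])
  fix a b assume "(a, b) \<in> E"
  then have "(a, b) \<in> (\<Union>i\<in>I. E' i)\<^sup>*" using E(3) by blast
  then show "Transposition.transpose a b \<in> S"
  proof (induction rule: rtrancl_induct)
    case base
    then show ?case using \<open>id \<in> S\<close> by (simp add: id_def)
  next
    case (step b c)
    from step.hyps(2) obtain i where i: "i \<in> I" "(b, c) \<in> E' i" by blast
    have bc: "Transposition.transpose b c \<in> S"
      using transpose_in_finitary_perms[OF E'[OF i(1)] i(2)] sub[OF i(1)] by (rule subsetD[rotated])
    show ?case
    proof (cases "a = b \<or> b = c \<or> a = c")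
      case True
      then show ?thesis using step.IH bc \<open>id \<in> S\<close> by (auto simp: id_def)
    next
      case False
      then have "Transposition.transpose a c = Transposition.transpose a b \<circ> Transposition.transpose b c \<circ> Transposition.transpose a b"
        by (intro ext) (auto simp add: Transposition.transpose_def)
      then show ?thesis using comp[OF comp[OF step.IH bc] step.IH] by (simp only:)
    qed
  qed
qed

text \<open>A permutation is determined by the finite graph of its restriction to its support.\<close>

lemma countable_finitary_perms:
  assumes "countable A"
  shows "countable (finitary_perms (A \<times> A))"
proof -
  define graph :: "('a \<Rightarrow> 'a) \<Rightarrow> ('a \<times> 'a) set" where "graph \<sigma> = {(a, \<sigma> a) | a. \<sigma> a \<noteq> a}" for \<sigma>
  have "inj graph"
  proof (rule injI, rule ext)
    fix \<sigma> \<tau> :: "'a \<Rightarrow> 'a" and a assume "graph \<sigma> = graph \<tau>"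
    then have "(a, b) \<in> graph \<sigma> \<longleftrightarrow> (a, b) \<in> graph \<tau>" for b by simp
    from this[of "\<sigma> a"] this[of "\<tau> a"] show "\<sigma> a = \<tau> a" by (auto simp: graph_def)
  qed
  moreover have "graph ` finitary_perms (A \<times> A) \<subseteq> {B. finite B \<and> B \<subseteq> A \<times> A}"
  proof (intro image_subsetI CollectI conjI)
    fix \<sigma> assume s: "\<sigma> \<in> finitary_perms (A \<times> A)"
    have "graph \<sigma> = (\<lambda>a. (a, \<sigma> a)) ` {a. \<sigma> a \<noteq> a}" by (auto simp: graph_def)
    with s show "finite (graph \<sigma>)" by (simp add: finitary_perms_def)
    from s show "graph \<sigma> \<subseteq> A \<times> A" unfolding graph_def finitary_perms_def by blast
  qed
  moreover have "countable {B. finite B \<and> B \<subseteq> A \<times> A}"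
    using assms by (intro countable_Collect_finite_subset countable_SIGMA)
  ultimately show ?thesis
    by (meson countable_image_inj_on countable_subset inj_on_subset subset_UNIV)
qed

lemma infinite_finitary_perms:
  assumes "infinite A"
  shows "infinite (finitary_perms (A \<times> A))"
proof -
  obtain a where a: "a \<in> A" using assms by fastforce
  have "inj_on (Transposition.transpose a) A"
    by (rule inj_onI) (metis transpose_apply_first)
  moreover have "Transposition.transpose a ` A \<subseteq> finitary_perms (A \<times> A)"
    using a by (auto intro!: transpose_in_finitary_perms simp: sym_def)
  ultimately show ?thesis using assms infinite_super finite_imageD by metis
qed


section \<open>Lattices of closed groups and closed monoids\<close>

lemma closedin_product_discrete_coordinates:
  assumes "i \<in> I" "j \<in> I"
  shows "closedin (product_topology (\<lambda>_. discrete_topology X) I) {f \<in> I \<rightarrow>\<^sub>E X. R (f i) (f j)}"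
proof -
  let ?T = "product_topology (\<lambda>_. discrete_topology X) I"
  have "continuous_map ?T (prod_topology (discrete_topology X) (discrete_topology X)) (\<lambda>f. (f i, f j))"
    using assms by (intro continuous_map_pairedI continuous_map_product_projection)
  then have "continuous_map ?T (discrete_topology (X \<times> X)) (\<lambda>f. (f i, f j))"
    by (simp add: prod_topology_discrete_topology)
  then have "closedin ?T {f \<in> topspace ?T. (f i, f j) \<in> {(a, b) \<in> X \<times> X. R a b}}"
    by (rule closedin_continuous_map_preimage) auto
  also have "{f \<in> topspace ?T. (f i, f j) \<in> {(a, b) \<in> X \<times> X. R a b}} = {f \<in> I \<rightarrow>\<^sub>E X. R (f i) (f j)}"
    using assms by auto
  finally show ?thesis .
qed

lemma closedin_Collect_Ball:
  assumes "\<And>i. i \<in> I \<Longrightarrow> closedin T {x \<in> topspace T. P i x}"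
  shows "closedin T {x \<in> topspace T. \<forall>i\<in>I. P i x}"
proof (cases "I = {}")
  case False
  then have "{x \<in> topspace T. \<forall>i\<in>I. P i x} = (\<Inter>i\<in>I. {x \<in> topspace T. P i x})" by auto
  then show ?thesis using False assms by (simp add: closedin_INT)
qed simp

lemma topspace_maps_topology [simp]: "topspace (maps_topology X) = X \<rightarrow>\<^sub>E X"
  by (simp add: maps_topology_def)

lemma topspace_nary_ops_topology [simp]: "topspace (nary_ops_topology X n) = nary_ops X n"
  by (simp add: nary_ops_topology_def nary_ops_def)

lemma Bij_subset_PiE: "Bij X \<subseteq> X \<rightarrow>\<^sub>E X"
  by (auto simp: Bij_def bij_betw_def PiE_def)

lemma carrier_BijGroup: "carrier (BijGroup X) = Bij X"
  by (simp add: BijGroup_def)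

lemma local_groups_top: "Bij X \<in> local_groups X"
proof -
  have "subgroup (Bij X) (BijGroup X)"
    using group.subgroup_self[OF group_BijGroup[of X]] by (simp add: BijGroup_def)
  moreover have "closedin (subtopology (maps_topology X) (Bij X)) (topspace (subtopology (maps_topology X) (Bij X)))"
    by (rule closedin_topspace)
  moreover have "topspace (subtopology (maps_topology X) (Bij X)) = Bij X"
    using Bij_subset_PiE[of X] by auto
  ultimately show ?thesis by (simp add: local_groups_def)
qed

lemma local_groups_subset: "A \<in> local_groups X \<Longrightarrow> A \<subseteq> Bij X"
  using subgroup.subset[of A "BijGroup X"] by (simp add: local_groups_def carrier_BijGroup)

lemma local_groups_Inter:
  assumes "\<A> \<subseteq> local_groups X" "\<A> \<noteq> {}"
  shows "\<Inter>\<A> \<in> local_groups X"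
  using assms group.subgroups_Inter[OF group_BijGroup, of \<A> X]
  by (auto simp: local_groups_def intro!: closedin_Inter)

lemma local_monoids_top: "X \<rightarrow>\<^sub>E X \<in> local_monoids X"
  using closedin_topspace[of "maps_topology X"]
  by (auto simp: local_monoids_def transformation_monoid_def compose_def)

lemma local_monoids_subset: "A \<in> local_monoids X \<Longrightarrow> A \<subseteq> X \<rightarrow>\<^sub>E X"
  by (auto simp: local_monoids_def transformation_monoid_def)

lemma local_monoids_Inter:
  assumes "\<A> \<subseteq> local_monoids X" "\<A> \<noteq> {}"
  shows "\<Inter>\<A> \<in> local_monoids X"
proof -
  have "closedin (maps_topology X) (\<Inter>\<A>)"
    using assms by (intro closedin_Inter) (auto simp: local_monoids_def)
  moreover have "transformation_monoid X (\<Inter>\<A>)"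
    using assms unfolding local_monoids_def transformation_monoid_def by blast
  ultimately show ?thesis by (simp add: local_monoids_def)
qed

lemma local_group_imp_transformation_monoid:
  assumes "A \<in> local_groups X"
  shows "transformation_monoid X A"
proof -
  have A: "subgroup A (BijGroup X)" using assms by (simp add: local_groups_def)
  then have sub: "A \<subseteq> Bij X" using local_groups_subset[OF assms] by simp
  have "compose X f g \<in> A" if "f \<in> A" "g \<in> A" for f g
    using subgroup.m_closed[OF A that] that sub by (simp add: BijGroup_def subset_iff)
  moreover have "(\<lambda>x\<in>X. x) \<in> A"
    using subgroup.one_closed[OF A] by (simp add: BijGroup_def)
  ultimately show ?thesis
    using subset_trans[OF sub Bij_subset_PiE] by (simp add: transformation_monoid_def)
qed


section \<open>The regular representation\<close>

text \<open>A monoid \<open>G\<close> of permutations, such as a group, acts on itself by left multiplication; \<open>label\<close> transports this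
  action to the set \<open>X\<close>. The point of the regular action is that a translation is determined by
  its value at a single point, so that the translations form a discrete set of maps and every
  subset of it is topologically closed.\<close>

locale regular_representation =
  fixes X :: "'a set" and G :: "('p \<Rightarrow> 'p) set" and label :: "'a \<Rightarrow> 'p \<Rightarrow> 'p"
  assumes label: "bij_betw label X G"
    and id_in: "id \<in> G"
    and comp_in: "\<sigma> \<in> G \<Longrightarrow> \<tau> \<in> G \<Longrightarrow> \<sigma> \<circ> \<tau> \<in> G"
    and bij_in: "\<sigma> \<in> G \<Longrightarrow> bij \<sigma>"
begin

definition unit :: 'a where "unit = inv_into X label id"

definition translation :: "('p \<Rightarrow> 'p) \<Rightarrow> 'a \<Rightarrow> 'a" where
  "translation \<sigma> = (\<lambda>x\<in>X. inv_into X label (\<sigma> \<circ> label x))"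

lemma label_in: "x \<in> X \<Longrightarrow> label x \<in> G"
  using label by (auto simp: bij_betw_def)

lemma label_eqD: "label x = label y \<Longrightarrow> x \<in> X \<Longrightarrow> y \<in> X \<Longrightarrow> x = y"
  using label by (auto simp: bij_betw_def inj_on_def)

lemma unit_in: "unit \<in> X" and label_unit: "label unit = id"
  using label id_in by (auto simp: unit_def bij_betw_def f_inv_into_f inv_into_into)

lemma translation_in: "\<sigma> \<in> G \<Longrightarrow> x \<in> X \<Longrightarrow> translation \<sigma> x \<in> X"
  and label_translation: "\<sigma> \<in> G \<Longrightarrow> x \<in> X \<Longrightarrow> label (translation \<sigma> x) = \<sigma> \<circ> label x"
  using label comp_in[OF _ label_in]
  by (auto simp: translation_def bij_betw_def f_inv_into_f inv_into_into)

lemma translation_in_PiE: "\<sigma> \<in> G \<Longrightarrow> translation \<sigma> \<in> X \<rightarrow>\<^sub>E X"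
  using translation_in by (auto simp: PiE_iff extensional_def translation_def)

lemma translation_unique:
  assumes "f \<in> X \<rightarrow>\<^sub>E X" "\<sigma> \<in> G" "\<And>x. x \<in> X \<Longrightarrow> label (f x) = \<sigma> \<circ> label x"
  shows "f = translation \<sigma>"
proof (rule PiE_ext[OF assms(1) translation_in_PiE[OF assms(2)]])
  fix x assume "x \<in> X"
  then have "label (f x) = label (translation \<sigma> x)"
    by (simp only: assms(3) label_translation[OF assms(2)])
  then show "f x = translation \<sigma> x"
    using PiE_mem[OF assms(1) \<open>x \<in> X\<close>] translation_in[OF assms(2) \<open>x \<in> X\<close>] by (rule label_eqD)
qed

lemma label_translation_unit: "\<sigma> \<in> G \<Longrightarrow> label (translation \<sigma> unit) = \<sigma>"
  by (simp only: label_translation[OF _ unit_in] label_unit comp_id)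

lemma inj_on_translation: "inj_on translation G"
  by (rule inj_on_inverseI[where g="\<lambda>f. label (f unit)"]) (rule label_translation_unit)

lemma translation_id: "translation id = (\<lambda>x\<in>X. x)"
  by (rule translation_unique[symmetric]) (auto simp: id_in)

lemma compose_translation:
  assumes "\<sigma> \<in> G" "\<tau> \<in> G"
  shows "compose X (translation \<sigma>) (translation \<tau>) = translation (\<sigma> \<circ> \<tau>)"
proof (rule translation_unique)
  show "compose X (translation \<sigma>) (translation \<tau>) \<in> X \<rightarrow>\<^sub>E X"
    using translation_in assms by (auto simp: compose_def)
  show "\<sigma> \<circ> \<tau> \<in> G" using assms by (rule comp_in)
  show "label (compose X (translation \<sigma>) (translation \<tau>) x) = \<sigma> \<circ> \<tau> \<circ> label x" if "x \<in> X" for x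
    using that by (simp add: compose_def o_assoc
        label_translation[OF assms(1) translation_in[OF assms(2)]] label_translation[OF assms(2)])
qed

text \<open>Membership is expressed through conditions that involve two values of the map at a time,
  which makes closedness evident. The first conjunct stands under the quantifier only to give all
  conditions the same form.\<close>

lemma translation_image_iff:
  assumes "H \<subseteq> G"
  shows "f \<in> translation ` H \<longleftrightarrow> f \<in> X \<rightarrow>\<^sub>E X \<and>
    (\<forall>x\<in>X. label (f unit) \<in> H \<and> label (f x) = label (f unit) \<circ> label x)"
proof
  assume "f \<in> translation ` H"
  then obtain \<sigma> where s: "\<sigma> \<in> H" "f = translation \<sigma>" by blast
  with assms have "\<sigma> \<in> G" by blast
  with s(1) show "f \<in> X \<rightarrow>\<^sub>E X \<and> (\<forall>x\<in>X. label (f unit) \<in> H \<and> label (f x) = label (f unit) \<circ> label x)"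
    unfolding s(2) by (intro conjI ballI) (simp_all only: label_translation_unit label_translation translation_in_PiE)
next
  assume f: "f \<in> X \<rightarrow>\<^sub>E X \<and> (\<forall>x\<in>X. label (f unit) \<in> H \<and> label (f x) = label (f unit) \<circ> label x)"
  note pointwise = bspec[OF conjunct2[OF f]]
  have fH: "label (f unit) \<in> H" by (rule conjunct1[OF pointwise[OF unit_in]])
  have eq: "label (f x) = label (f unit) \<circ> label x" if "x \<in> X" for x
    by (rule conjunct2[OF pointwise[OF that]])
  have "f = translation (label (f unit))"
    by (rule translation_unique[OF conjunct1[OF f] subsetD[OF assms fH] eq])
  then show "f \<in> translation ` H" by (rule image_eqI[OF _ fH])
qed

lemma closedin_translation_image:
  assumes "H \<subseteq> G"
  shows "closedin (maps_topology X) (translation ` H)"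
proof -
  have "closedin (maps_topology X)
    {f \<in> topspace (maps_topology X). \<forall>x\<in>X. label (f unit) \<in> H \<and> label (f x) = label (f unit) \<circ> label x}"
    unfolding maps_topology_def
    by (intro closedin_Collect_Ball)
      (simp add: closedin_product_discrete_coordinates[OF unit_in,
        where R="\<lambda>a b. label a \<in> H \<and> label b = label a \<circ> label _"])
  also have "{f \<in> topspace (maps_topology X). \<forall>x\<in>X. label (f unit) \<in> H \<and> label (f x) = label (f unit) \<circ> label x}
      = translation ` H"
    by (rule Set.set_eqI) (simp only: translation_image_iff[OF assms] mem_Collect_eq topspace_maps_topology)
  finally show ?thesis .
qed

lemma translation_monoid_local:
  assumes "H \<subseteq> G" "id \<in> H" "\<And>\<sigma> \<tau>. \<sigma> \<in> H \<Longrightarrow> \<tau> \<in> H \<Longrightarrow> \<sigma> \<circ> \<tau> \<in> H"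
  shows "translation ` H \<in> local_monoids X"
proof -
  have "translation ` H \<subseteq> X \<rightarrow>\<^sub>E X" using assms(1) translation_in_PiE by blast
  moreover have "(\<lambda>x\<in>X. x) \<in> translation ` H"
    using assms(2) by (subst translation_id[symmetric]) (rule imageI)
  moreover have "compose X f g \<in> translation ` H"
    if fg: "f \<in> translation ` H" "g \<in> translation ` H" for f g
  proof -
    obtain \<sigma> \<tau> where st: "f = translation \<sigma>" "g = translation \<tau>" "\<sigma> \<in> H" "\<tau> \<in> H"
      using fg by blast
    then have "compose X f g = translation (\<sigma> \<circ> \<tau>)"
      using compose_translation[of \<sigma> \<tau>] assms(1) by (simp add: subset_iff)
    then show ?thesis using assms(3)[OF st(3,4)] by (rule image_eqI)
  qed
  ultimately show ?thesis
    by (simp add: local_monoids_def transformation_monoid_def closedin_translation_image[OF assms(1)])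
qed

lemma translation_Bij:
  assumes "\<sigma> \<in> G" "inv_into UNIV \<sigma> \<in> G"
  shows "translation \<sigma> \<in> Bij X" "inv\<^bsub>BijGroup X\<^esub> (translation \<sigma>) = translation (inv_into UNIV \<sigma>)"
proof -
  let ?\<tau> = "inv_into UNIV \<sigma>"
  have b: "?\<tau> \<circ> \<sigma> = id" "\<sigma> \<circ> ?\<tau> = id"
    using bij_in[OF assms(1)] by (auto simp: bij_def surj_iff[symmetric])
  have c: "compose X (translation ?\<tau>) (translation \<sigma>) = (\<lambda>x\<in>X. x)"
    "compose X (translation \<sigma>) (translation ?\<tau>) = (\<lambda>x\<in>X. x)"
    using compose_translation assms b by (simp_all add: translation_id)
  have "translation ?\<tau> (translation \<sigma> x) = x" "translation \<sigma> (translation ?\<tau> x) = x" if "x \<in> X" for x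
    using fun_cong[OF c(1), of x] fun_cong[OF c(2), of x] that by (simp_all add: compose_def)
  then have bb: "bij_betw (translation \<sigma>) X X" "bij_betw (translation ?\<tau>) X X"
    using bij_betwI[of "translation \<sigma>" X X "translation ?\<tau>"]
      bij_betwI[of "translation ?\<tau>" X X "translation \<sigma>"] translation_in assms
    by blast+
  then show s: "translation \<sigma> \<in> Bij X"
    using translation_in_PiE[OF assms(1)] by (simp add: Bij_def PiE_def)
  have t: "translation ?\<tau> \<in> Bij X"
    using translation_in_PiE[OF assms(2)] bb by (simp add: Bij_def PiE_def)
  show "inv\<^bsub>BijGroup X\<^esub> (translation \<sigma>) = translation ?\<tau>"
    by (rule group.inv_equality[OF group_BijGroup]) (use s t c in \<open>simp_all add: BijGroup_def\<close>)
qed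

lemma translation_group_local:
  assumes "H \<subseteq> G" "id \<in> H" "\<And>\<sigma> \<tau>. \<sigma> \<in> H \<Longrightarrow> \<tau> \<in> H \<Longrightarrow> \<sigma> \<circ> \<tau> \<in> H"
    and inv: "\<And>\<sigma>. \<sigma> \<in> H \<Longrightarrow> inv_into UNIV \<sigma> \<in> H"
  shows "translation ` H \<in> local_groups X"
proof -
  have M: "transformation_monoid X (translation ` H)"
    using translation_monoid_local[OF assms(1-3)] by (simp add: local_monoids_def)
  have sub: "translation ` H \<subseteq> Bij X"
    using translation_Bij(1) inv assms(1) by blast
  have "subgroup (translation ` H) (BijGroup X)"
  proof
    show "translation ` H \<subseteq> carrier (BijGroup X)" using sub by (simp add: carrier_BijGroup)
    show "\<one>\<^bsub>BijGroup X\<^esub> \<in> translation ` H"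
      using M by (simp add: BijGroup_def transformation_monoid_def)
    fix f g assume fg: "f \<in> translation ` H" "g \<in> translation ` H"
    then have "f \<in> Bij X" "g \<in> Bij X" using sub by auto
    then have "f \<otimes>\<^bsub>BijGroup X\<^esub> g = compose X f g" by (simp add: BijGroup_def)
    moreover have "compose X f g \<in> translation ` H"
      using M fg unfolding transformation_monoid_def by blast
    ultimately show "f \<otimes>\<^bsub>BijGroup X\<^esub> g \<in> translation ` H" by simp
  next
    fix f assume "f \<in> translation ` H"
    then obtain \<sigma> where s: "f = translation \<sigma>" "\<sigma> \<in> H" by blast
    then have "inv\<^bsub>BijGroup X\<^esub> f = translation (inv_into UNIV \<sigma>)"
      using translation_Bij(2)[of \<sigma>] inv assms(1) by blast
    then show "inv\<^bsub>BijGroup X\<^esub> f \<in> translation ` H" using inv s by simp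
  qed
  moreover have "closedin (subtopology (maps_topology X) (Bij X)) (translation ` H)"
    using closedin_translation_image[OF assms(1)] sub by (auto simp: closedin_subtopology)
  ultimately show ?thesis by (simp add: local_groups_def)
qed

lemma translation_Inter:
  assumes "I \<noteq> {}" "\<And>i. i \<in> I \<Longrightarrow> H i \<subseteq> G"
  shows "translation ` (\<Inter>i\<in>I. H i) = (\<Inter>i\<in>I. translation ` H i)"
proof -
  obtain i where "i \<in> I" using assms(1) by blast
  with assms(2) show ?thesis by (intro image_INT[OF inj_on_translation]) auto
qed

end


section \<open>The lattice of local clones\<close>

lemma local_clones_top: "operations X \<in> local_clones X"
proof -
  have "comp_op X n m f g \<in> nary_ops X m"
    if "f \<in> nary_ops X n" "\<forall>i\<in>{1..n}. g i \<in> nary_ops X m" for n m f g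
  proof -
    have "f (\<lambda>i\<in>{1..n}. g i x) \<in> X" if x: "x \<in> tuples X m" for x
    proof -
      have "(\<lambda>i\<in>{1..n}. g i x) \<in> tuples X n"
        using x \<open>\<forall>i\<in>{1..n}. g i \<in> nary_ops X m\<close> by (auto simp: tuples_def nary_ops_def)
      then show ?thesis using \<open>f \<in> nary_ops X n\<close> by (auto simp: nary_ops_def)
    qed
    then show ?thesis by (auto simp: comp_op_def nary_ops_def)
  qed
  moreover have "proj_op X n k \<in> nary_ops X n" if "k \<in> {1..n}" for n k
    using that by (auto simp: proj_op_def nary_ops_def tuples_def)
  ultimately have "clone X (operations X)"
    unfolding clone_def operations_def by (force simp: Ball_def)
  moreover have "operations X `` {n} = topspace (nary_ops_topology X n)" if "n \<ge> 1" for n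
    using that by (auto simp: operations_def)
  ultimately show ?thesis
    using closedin_topspace[of "nary_ops_topology X _"] unfolding local_clones_def by simp
qed

lemma local_clones_subset: "A \<in> local_clones X \<Longrightarrow> A \<subseteq> operations X"
  by (auto simp: local_clones_def clone_def)

lemma local_clones_Inter:
  assumes "\<A> \<subseteq> local_clones X" "\<A> \<noteq> {}"
  shows "\<Inter>\<A> \<in> local_clones X"
proof -
  have clones: "clone X C" if "C \<in> \<A>" for C using that assms by (auto simp: local_clones_def)
  have "clone X (\<Inter>\<A>)"
    unfolding clone_def
  proof (intro conjI allI ballI impI)
    show "\<Inter>\<A> \<subseteq> operations X" using clones assms unfolding clone_def by blast
    show "(n, proj_op X n k) \<in> \<Inter>\<A>" if "k \<in> {1..n}" for n k
      using clones that unfolding clone_def by blast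
    show "(m, comp_op X n m f g) \<in> \<Inter>\<A>" if "(n, f) \<in> \<Inter>\<A>" "\<forall>i\<in>{1..n}. (m, g i) \<in> \<Inter>\<A>" for n m f g
    proof
      fix C assume "C \<in> \<A>"
      then have "(n, f) \<in> C" "\<forall>i\<in>{1..n}. (m, g i) \<in> C" using that by auto
      then show "(m, comp_op X n m f g) \<in> C" using clones[OF \<open>C \<in> \<A>\<close>] unfolding clone_def by blast
    qed
  qed
  moreover have "closedin (nary_ops_topology X n) (\<Inter>\<A> `` {n})" if "n \<ge> 1" for n
  proof -
    have "\<Inter>\<A> `` {n} = (\<Inter>C\<in>\<A>. C `` {n})" by auto
    then show ?thesis using assms that by (auto simp: local_clones_def intro!: closedin_INT)
  qed
  ultimately show ?thesis by (simp add: local_clones_def)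
qed


section \<open>Essentially unary operations\<close>

lemma clone_proj_op: "clone X C \<Longrightarrow> k \<in> {1..n} \<Longrightarrow> (n, proj_op X n k) \<in> C"
  by (simp add: clone_def)

lemma clone_comp_op:
  assumes "clone X C" "(n, f) \<in> C" "\<And>i. i \<in> {1..n} \<Longrightarrow> (m, g i) \<in> C"
  shows "(m, comp_op X n m f g) \<in> C"
proof -
  from assms(1) have "\<forall>n m f g. (n, f) \<in> C \<longrightarrow> (\<forall>i\<in>{1..n}. (m, g i) \<in> C) \<longrightarrow> (m, comp_op X n m f g) \<in> C"
    unfolding clone_def by (elim conjE)
  then show ?thesis using assms(2,3) by (simp del: atLeastAtMost_iff)
qed

definition lift_unary :: "'a set \<Rightarrow> nat \<Rightarrow> nat \<Rightarrow> ('a \<Rightarrow> 'a) \<Rightarrow> (nat \<Rightarrow> 'a) \<Rightarrow> 'a" where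
  "lift_unary X n k f = (\<lambda>x\<in>tuples X n. f (x k))"

text \<open>The operations that depend on at most one argument, through a map in \<open>M\<close>. For a monoid \<open>M\<close>
  this is the clone generated by \<open>M\<close>.\<close>

definition essentially_unary :: "'a set \<Rightarrow> ('a \<Rightarrow> 'a) set \<Rightarrow> (nat \<times> ((nat \<Rightarrow> 'a) \<Rightarrow> 'a)) set" where
  "essentially_unary X M = {(n, lift_unary X n k f) | n k f. k \<in> {1..n} \<and> f \<in> M}"

definition diagonal :: "nat \<Rightarrow> 'a \<Rightarrow> nat \<Rightarrow> 'a" where
  "diagonal n a = (\<lambda>i\<in>{1..n}. a)"

lemma diagonal_in: "a \<in> X \<Longrightarrow> diagonal n a \<in> tuples X n"
  by (auto simp: tuples_def diagonal_def)

lemma diagonal_nth: "k \<in> {1..n} \<Longrightarrow> diagonal n a k = a"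
  by (simp add: diagonal_def)

lemma tuples_nth: "x \<in> tuples X n \<Longrightarrow> k \<in> {1..n} \<Longrightarrow> x k \<in> X"
  by (auto simp: tuples_def)

lemma lift_unary_diagonal:
  assumes "f \<in> X \<rightarrow>\<^sub>E X" "k \<in> {1..n}"
  shows "(\<lambda>a\<in>X. lift_unary X n k f (diagonal n a)) = f"
proof
  fix a show "(\<lambda>a\<in>X. lift_unary X n k f (diagonal n a)) a = f a"
  proof (cases "a \<in> X")
    case True
    then show ?thesis
      by (simp only: restrict_apply lift_unary_def diagonal_in diagonal_nth[OF assms(2)] if_True)
  next
    case False
    then show ?thesis using PiE_arb[OF assms(1)] by simp
  qed
qed

lemma lift_unary_in: "f \<in> X \<rightarrow>\<^sub>E X \<Longrightarrow> k \<in> {1..n} \<Longrightarrow> lift_unary X n k f \<in> nary_ops X n"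
  using tuples_nth by (fastforce simp: lift_unary_def nary_ops_def)

text \<open>The unary map underlying an essentially unary operation is recovered from the diagonal, even
  for a constant operation, where the argument it depends on is not unique. This turns closedness
  and compatibility with intersections into properties of the map \<open>F \<mapsto> F \<circ> diagonal\<close>.\<close>

lemma essentially_unary_iff:
  assumes M: "M \<subseteq> X \<rightarrow>\<^sub>E X"
  shows "(n, F) \<in> essentially_unary X M \<longleftrightarrow>
    F \<in> nary_ops X n \<and> (\<lambda>a\<in>X. F (diagonal n a)) \<in> M \<and>
    (\<exists>k\<in>{1..n}. \<forall>x\<in>tuples X n. F x = F (diagonal n (x k)))"
proof
  assume "(n, F) \<in> essentially_unary X M"
  then obtain k f where F: "F = lift_unary X n k f" "k \<in> {1..n}" "f \<in> M"
    by (auto simp: essentially_unary_def)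
  then have f: "f \<in> X \<rightarrow>\<^sub>E X" using M by blast
  have "F x = F (diagonal n (x k))" if "x \<in> tuples X n" for x
    using that tuples_nth[OF that F(2)] by (simp add: F(1) lift_unary_def diagonal_in diagonal_nth[OF F(2)])
  moreover have "(\<lambda>a\<in>X. F (diagonal n a)) \<in> M"
    using lift_unary_diagonal[OF f F(2)] F(1,3) by simp
  ultimately show "F \<in> nary_ops X n \<and> (\<lambda>a\<in>X. F (diagonal n a)) \<in> M \<and>
    (\<exists>k\<in>{1..n}. \<forall>x\<in>tuples X n. F x = F (diagonal n (x k)))"
    using lift_unary_in[OF f F(2)] F(1,2) by blast
next
  assume *: "F \<in> nary_ops X n \<and> (\<lambda>a\<in>X. F (diagonal n a)) \<in> M \<and>
    (\<exists>k\<in>{1..n}. \<forall>x\<in>tuples X n. F x = F (diagonal n (x k)))"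
  then obtain k where k: "k \<in> {1..n}" "\<And>x. x \<in> tuples X n \<Longrightarrow> F x = F (diagonal n (x k))" by blast
  have "F = lift_unary X n k (\<lambda>a\<in>X. F (diagonal n a))"
  proof
    fix x show "F x = lift_unary X n k (\<lambda>a\<in>X. F (diagonal n a)) x"
    proof (cases "x \<in> tuples X n")
      case True
      then show ?thesis using k(2)[OF True] tuples_nth[OF True k(1)] by (simp add: lift_unary_def)
    next
      case False
      then show ?thesis using * by (auto simp: lift_unary_def nary_ops_def)
    qed
  qed
  with k * show "(n, F) \<in> essentially_unary X M" unfolding essentially_unary_def by blast
qed

lemma essentially_unary_clone:
  assumes "transformation_monoid X M"
  shows "clone X (essentially_unary X M)"
proof -
  have M: "M \<subseteq> X \<rightarrow>\<^sub>E X" "(\<lambda>x\<in>X. x) \<in> M" "\<And>f g. f \<in> M \<Longrightarrow> g \<in> M \<Longrightarrow> compose X f g \<in> M"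
    using assms by (auto simp: transformation_monoid_def)
  have ops: "F \<in> nary_ops X n" if "(n, F) \<in> essentially_unary X M" for n F
    using that essentially_unary_iff[OF M(1)] by blast
  show ?thesis
    unfolding clone_def
  proof (intro conjI allI ballI impI)
    show "essentially_unary X M \<subseteq> operations X"
    proof (rule subrelI)
      fix n F assume nF: "(n, F) \<in> essentially_unary X M"
      then have "1 \<le> n" by (auto simp: essentially_unary_def)
      with ops[OF nF] show "(n, F) \<in> operations X" by (auto simp: operations_def)
    qed
    fix n k :: nat assume k: "k \<in> {1..n}"
    have "proj_op X n k = lift_unary X n k (\<lambda>x\<in>X. x)"
      using tuples_nth[OF _ k, of _ X] by (auto simp: proj_op_def lift_unary_def intro!: restrict_ext)
    then show "(n, proj_op X n k) \<in> essentially_unary X M"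
      using M(2) k unfolding essentially_unary_def by blast
  next
    fix n m f g
    assume f: "(n, f) \<in> essentially_unary X M" and g: "\<forall>i\<in>{1..n}. (m, g i) \<in> essentially_unary X M"
    obtain k f' where f': "f = lift_unary X n k f'" "k \<in> {1..n}" "f' \<in> M"
      using f by (auto simp: essentially_unary_def)
    obtain l g' where g': "g k = lift_unary X m l g'" "l \<in> {1..m}" "g' \<in> M"
      using bspec[OF g f'(2)] by (auto simp: essentially_unary_def)
    have "(\<lambda>i\<in>{1..n}. g i x) \<in> tuples X n" if "x \<in> tuples X m" for x
      using g ops that by (auto simp: tuples_def[of X n] nary_ops_def)
    then have "comp_op X n m f g = lift_unary X m l (compose X f' g')"
      using f'(1,2) g'(1,2) by (auto simp: comp_op_def lift_unary_def compose_def tuples_nth intro!: restrict_ext)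
    then show "(m, comp_op X n m f g) \<in> essentially_unary X M"
      using M(3)[OF f'(3) g'(3)] g'(2) unfolding essentially_unary_def by blast
  qed
qed

lemma continuous_map_diagonal:
  "continuous_map (nary_ops_topology X n) (maps_topology X) (\<lambda>F. \<lambda>a\<in>X. F (diagonal n a))"
  unfolding maps_topology_def continuous_map_componentwise
proof (intro conjI ballI)
  fix a assume "a \<in> X"
  then show "continuous_map (nary_ops_topology X n) (discrete_topology X) (\<lambda>F. (\<lambda>a\<in>X. F (diagonal n a)) a)"
    unfolding nary_ops_topology_def
    using continuous_map_product_projection[OF diagonal_in[OF \<open>a \<in> X\<close>], of "\<lambda>_. discrete_topology X" n]
    by simp
qed auto

lemma essentially_unary_local:
  assumes "M \<in> local_monoids X"
  shows "essentially_unary X M \<in> local_clones X"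
proof -
  have M: "transformation_monoid X M" "closedin (maps_topology X) M" "M \<subseteq> X \<rightarrow>\<^sub>E X"
    using assms local_monoids_subset by (auto simp: local_monoids_def)
  have "closedin (nary_ops_topology X n) (essentially_unary X M `` {n})" for n
  proof -
    let ?T = "nary_ops_topology X n"
    have "closedin ?T {F \<in> topspace ?T. \<forall>x\<in>tuples X n. F x = F (diagonal n (x k))}" if "k \<in> {1..n}" for k
      unfolding nary_ops_topology_def
      by (intro closedin_Collect_Ball)
        (simp add: closedin_product_discrete_coordinates[where R="(=)"] diagonal_in tuples_nth[OF _ that])
    then have "closedin ?T (\<Union>k\<in>{1..n}. {F \<in> topspace ?T. \<forall>x\<in>tuples X n. F x = F (diagonal n (x k))})"
      by (intro closedin_Union) auto
    moreover have "closedin ?T {F \<in> topspace ?T. (\<lambda>a\<in>X. F (diagonal n a)) \<in> M}"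
      by (rule closedin_continuous_map_preimage[OF continuous_map_diagonal M(2)])
    moreover have "essentially_unary X M `` {n} =
        (\<Union>k\<in>{1..n}. {F \<in> topspace ?T. \<forall>x\<in>tuples X n. F x = F (diagonal n (x k))}) \<inter>
        {F \<in> topspace ?T. (\<lambda>a\<in>X. F (diagonal n a)) \<in> M}"
      using essentially_unary_iff[OF M(3), of n] by auto
    ultimately show ?thesis by (simp only: closedin_Int)
  qed
  then show ?thesis using essentially_unary_clone[OF M(1)] by (simp add: local_clones_def)
qed

lemma essentially_unary_reflects:
  assumes "M \<subseteq> X \<rightarrow>\<^sub>E X" "N \<subseteq> X \<rightarrow>\<^sub>E X" "essentially_unary X M \<subseteq> essentially_unary X N"
  shows "M \<subseteq> N"
proof
  fix f assume f: "f \<in> M"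
  have one: "(1::nat) \<in> {1..1}" by simp
  have "(1, lift_unary X 1 1 f) \<in> essentially_unary X M"
    using f one unfolding essentially_unary_def by blast
  then have "(\<lambda>a\<in>X. lift_unary X 1 1 f (diagonal 1 a)) \<in> N"
    using assms(3) essentially_unary_iff[OF assms(2)] by blast
  then show "f \<in> N"
    using lift_unary_diagonal[OF _ one] f assms(1) by (metis subsetD)
qed

lemma essentially_unary_Inter:
  assumes "I \<noteq> {}" "\<And>i. i \<in> I \<Longrightarrow> M i \<subseteq> X \<rightarrow>\<^sub>E X"
  shows "essentially_unary X (\<Inter>i\<in>I. M i) = (\<Inter>i\<in>I. essentially_unary X (M i))"
proof -
  have "(\<Inter>i\<in>I. M i) \<subseteq> X \<rightarrow>\<^sub>E X" using assms by blast
  note iff = essentially_unary_iff[OF this] essentially_unary_iff[OF assms(2)]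
  have "(n, F) \<in> essentially_unary X (\<Inter>i\<in>I. M i) \<longleftrightarrow> (\<forall>i\<in>I. (n, F) \<in> essentially_unary X (M i))" for n F
    using assms(1) by (simp only: iff cong: ball_cong) blast
  then show ?thesis by auto
qed

lemma unary_part_transformation_monoid:
  assumes C: "clone X C"
  shows "transformation_monoid X {f \<in> X \<rightarrow>\<^sub>E X. (1, lift_unary X 1 1 f) \<in> C}"
proof -
  have t: "x (Suc 0) \<in> X" if "x \<in> tuples X (Suc 0)" for x using tuples_nth[OF that, of 1] by simp
  have "lift_unary X 1 1 (\<lambda>x\<in>X. x) = proj_op X 1 1"
    using t by (auto simp: lift_unary_def proj_op_def intro!: restrict_ext)
  then have "(1, lift_unary X 1 1 (\<lambda>x\<in>X. x)) \<in> C"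
    using clone_proj_op[OF C, of 1 1] by simp
  moreover have "(1, lift_unary X 1 1 (compose X f g)) \<in> C"
    if "(1, lift_unary X 1 1 f) \<in> C" "(1, lift_unary X 1 1 g) \<in> C" "g \<in> X \<rightarrow>\<^sub>E X" for f g
  proof -
    have "(\<lambda>i\<in>{1..1}. g (x 1)) \<in> tuples X 1" if "x \<in> tuples X 1" for x
      using t that \<open>g \<in> X \<rightarrow>\<^sub>E X\<close> by (auto simp: tuples_def)
    then have "comp_op X 1 1 (lift_unary X 1 1 f) (\<lambda>_. lift_unary X 1 1 g) = lift_unary X 1 1 (compose X f g)"
      using t by (auto simp: comp_op_def lift_unary_def compose_def intro!: restrict_ext)
    moreover have "(1, comp_op X 1 1 (lift_unary X 1 1 f) (\<lambda>_. lift_unary X 1 1 g)) \<in> C"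
      by (rule clone_comp_op[OF C that(1) that(2)])
    ultimately show ?thesis by simp
  qed
  ultimately show ?thesis
    by (auto simp: transformation_monoid_def compose_def)
qed

text \<open>The unary members of a clone form a transformation monoid, and the other essentially unary
  operations arise from them by composition with projections.\<close>

lemma essentially_unary_join:
  assumes C: "clone X C" and M: "M \<subseteq> X \<rightarrow>\<^sub>E X" "\<And>i. i \<in> I \<Longrightarrow> N i \<subseteq> X \<rightarrow>\<^sub>E X"
    and sub: "\<And>i. i \<in> I \<Longrightarrow> essentially_unary X (N i) \<subseteq> C"
    and join: "\<And>P. transformation_monoid X P \<Longrightarrow> (\<And>i. i \<in> I \<Longrightarrow> N i \<subseteq> P) \<Longrightarrow> M \<subseteq> P"
  shows "essentially_unary X M \<subseteq> C"
proof -
  have one: "(1::nat) \<in> {1..1}" by simp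
  have "N i \<subseteq> {f \<in> X \<rightarrow>\<^sub>E X. (1, lift_unary X 1 1 f) \<in> C}" if "i \<in> I" for i
  proof
    fix f assume f: "f \<in> N i"
    then have "(1, lift_unary X 1 1 f) \<in> essentially_unary X (N i)"
      using one unfolding essentially_unary_def by blast
    then show "f \<in> {f \<in> X \<rightarrow>\<^sub>E X. (1, lift_unary X 1 1 f) \<in> C}"
      using f sub[OF that] M(2)[OF that] by blast
  qed
  then have MC: "M \<subseteq> {f \<in> X \<rightarrow>\<^sub>E X. (1, lift_unary X 1 1 f) \<in> C}"
    using join[OF unary_part_transformation_monoid[OF C]] by blast
  show ?thesis
    unfolding essentially_unary_def
  proof clarify
    fix n k :: nat and f assume k: "k \<in> {1..n}" and f: "f \<in> M"
    have "(\<lambda>i\<in>{1..1}. proj_op X n k x) \<in> tuples X 1" if "x \<in> tuples X n" for x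
      using tuples_nth[OF that k] that by (simp add: proj_op_def) (simp add: tuples_def)
    then have "comp_op X 1 n (lift_unary X 1 1 f) (\<lambda>_. proj_op X n k) = lift_unary X n k f"
      by (auto simp: comp_op_def lift_unary_def proj_op_def intro!: restrict_ext)
    moreover have "(1, lift_unary X 1 1 f) \<in> C" using MC f by blast
    ultimately show "(n, lift_unary X n k f) \<in> C"
      using clone_comp_op[OF C, of 1 "lift_unary X 1 1 f" n "\<lambda>_. proj_op X n k"] clone_proj_op[OF C k]
      by simp
  qed
qed


section \<open>Compact elements of an algebraic lattice\<close>

context algebraic_lattice
begin

definition compacts_below :: "'a \<Rightarrow> 'a set" where
  "compacts_below x = {c. compact_element L c \<and> c \<sqsubseteq> x}"

lemma compact_carrier: "compact_element L c \<Longrightarrow> c \<in> carrier L"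
  by (simp add: compact_element_def)

lemma compacts_below_carrier: "compacts_below x \<subseteq> carrier L"
  by (auto simp: compacts_below_def compact_carrier)

lemma compacts_below_mono:
  "x \<in> carrier L \<Longrightarrow> y \<in> carrier L \<Longrightarrow> x \<sqsubseteq> y \<Longrightarrow> compacts_below x \<subseteq> compacts_below y"
  by (auto simp: compacts_below_def intro: le_trans compact_carrier)

text \<open>Algebraicity enters here: elements are determined by the compact elements below them.\<close>

lemma Sup_compacts_below:
  assumes x: "x \<in> carrier L" shows "\<Squnion>(compacts_below x) = x"
proof (rule le_antisym)
  obtain A where A: "\<forall>c\<in>A. compact_element L c" "x = \<Squnion>A" using join_of_compact[OF x] by blast
  then have "A \<subseteq> carrier L" using compact_carrier by blast
  then have "A \<subseteq> compacts_below x"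
    using A sup_upper by (auto simp: compacts_below_def)
  then show "x \<sqsubseteq> \<Squnion>(compacts_below x)"
    unfolding A(2) using compacts_below_carrier \<open>A \<subseteq> carrier L\<close>
    by (intro sup_least sup_upper) auto
  show "\<Squnion>(compacts_below x) \<sqsubseteq> x"
    using x by (intro sup_least compacts_below_carrier) (auto simp: compacts_below_def)
qed (use x compacts_below_carrier in auto)

lemma compacts_below_reflects:
  assumes "x \<in> carrier L" "y \<in> carrier L" "compacts_below x \<subseteq> compacts_below y"
  shows "x \<sqsubseteq> y"
proof -
  have "\<Squnion>(compacts_below x) \<sqsubseteq> y"
    using assms by (intro sup_least compacts_below_carrier) (auto simp: compacts_below_def)
  then show ?thesis using Sup_compacts_below assms by simp
qed

lemma compacts_below_Inf:
  assumes "A \<subseteq> carrier L"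
  shows "A \<noteq> {} \<Longrightarrow> compacts_below (\<Sqinter>A) = (\<Inter>x\<in>A. compacts_below x)"
proof -
  assume "A \<noteq> {}"
  have "c \<sqsubseteq> \<Sqinter>A \<longleftrightarrow> (\<forall>x\<in>A. c \<sqsubseteq> x)" if c: "compact_element L c" for c
  proof
    assume *: "c \<sqsubseteq> \<Sqinter>A"
    show "\<forall>x\<in>A. c \<sqsubseteq> x"
    proof
      fix x assume "x \<in> A"
      then show "c \<sqsubseteq> x"
        using assms inf_lower[OF assms] compact_carrier[OF c] by (intro le_trans[OF *]) auto
    qed
  next
    assume "\<forall>x\<in>A. c \<sqsubseteq> x"
    then show "c \<sqsubseteq> \<Sqinter>A"
      using compact_carrier[OF c] by (intro inf_greatest assms) auto
  qed
  then show ?thesis using \<open>A \<noteq> {}\<close> by (auto simp: compacts_below_def)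
qed

lemma compacts_below_Sup:
  assumes A: "A \<subseteq> carrier L"
  shows "compacts_below (\<Squnion>A) = compacts_below (\<Squnion>(\<Union>x\<in>A. compacts_below x))"
proof -
  let ?U = "\<Union>x\<in>A. compacts_below x"
  have U: "?U \<subseteq> carrier L" using compacts_below_carrier by blast
  have "\<Squnion>A = \<Squnion>?U"
  proof (rule le_antisym)
    show "\<Squnion>A \<sqsubseteq> \<Squnion>?U"
    proof (rule sup_least[OF A])
      fix x assume x: "x \<in> A"
      have "\<Squnion>(compacts_below x) \<sqsubseteq> \<Squnion>?U"
        using x U compacts_below_carrier by (intro sup_least sup_upper) auto
      then show "x \<sqsubseteq> \<Squnion>?U" using Sup_compacts_below x A by auto
    qed (use U in auto)
    show "\<Squnion>?U \<sqsubseteq> \<Squnion>A"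
    proof (rule sup_least[OF U])
      fix c assume "c \<in> ?U"
      then obtain x where x: "x \<in> A" "compact_element L c" "c \<sqsubseteq> x" by (auto simp: compacts_below_def)
      then show "c \<sqsubseteq> \<Squnion>A" using A sup_upper[OF A] compact_carrier by (intro le_trans[OF x(3)]) auto
    qed (use A in auto)
  qed (use A U in auto)
  then show ?thesis by simp
qed

text \<open>Finitariness of the closure operator is compactness of the elements of its base set.\<close>

lemma finitary_closure_compacts:
  "finitary_closure {c. compact_element L c} (\<lambda>C. compacts_below (\<Squnion>C))"
proof
  let ?K = "{c. compact_element L c}"
  have K: "C \<subseteq> carrier L" if "C \<subseteq> ?K" for C
    using that compact_carrier by blast
  fix C D assume C: "C \<subseteq> ?K"
  show "C \<subseteq> compacts_below (\<Squnion>C)"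
    using C sup_upper[OF K[OF C]] by (auto simp: compacts_below_def)
  show "compacts_below (\<Squnion>C) \<subseteq> compacts_below (\<Squnion>D)"
    if D: "D \<subseteq> ?K" "C \<subseteq> compacts_below (\<Squnion>D)"
  proof (rule compacts_below_mono)
    show "\<Squnion>C \<sqsubseteq> \<Squnion>D"
      using D(2) K[OF D(1)] by (intro sup_least[OF K[OF C]]) (auto simp: compacts_below_def)
  qed (use K[OF C] K[OF D(1)] in auto)
  fix c assume "c \<in> compacts_below (\<Squnion>C)"
  then have c: "compact_element L c" "c \<sqsubseteq> \<Squnion>C" by (auto simp: compacts_below_def)
  then obtain B where "B \<subseteq> C" "finite B" "c \<sqsubseteq> \<Squnion>B"
    using K[OF C] unfolding compact_element_def by blast
  then show "\<exists>B\<subseteq>C. finite B \<and> c \<in> compacts_below (\<Squnion>B)"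
    using c(1) by (auto simp: compacts_below_def)
qed

end


section \<open>Representations of an algebraic lattice\<close>

text \<open>A lattice of equivalence relations on a countable set, with intersections as meets and
  transitive closures of unions as joins. The join condition is only stated as an inclusion because
  the other one follows from the compatibility with meets.\<close>

lemma (in algebraic_lattice) equivalence_representation:
  assumes "countable {c. compact_element L c}"
  obtains A :: "'a point set" and E
  where "countable A" "infinite A"
    and "\<And>x. E x \<subseteq> A \<times> A" "\<And>x a. a \<in> A \<Longrightarrow> (a, a) \<in> E x" "\<And>x. sym (E x)"
    and "\<And>x. x \<in> carrier L \<Longrightarrow> trans (E x)"
    and "\<And>x y. x \<in> carrier L \<Longrightarrow> y \<in> carrier L \<Longrightarrow> E x \<subseteq> E y \<Longrightarrow> x \<sqsubseteq> y"
    and "\<And>S. S \<subseteq> carrier L \<Longrightarrow> S \<noteq> {} \<Longrightarrow> E (\<Sqinter>S) = (\<Inter>x\<in>S. E x)"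
    and "\<And>S. S \<subseteq> carrier L \<Longrightarrow> S \<noteq> {} \<Longrightarrow> E (\<Squnion>S) \<subseteq> (\<Union>x\<in>S. E x)\<^sup>*"
proof -
  let ?K = "{c. compact_element L c}"
  interpret finitary_closure ?K "\<lambda>C. compacts_below (\<Squnion>C)"
    by (rule finitary_closure_compacts)
  have closed: "closed_set (compacts_below x)" if "x \<in> carrier L" for x
    using that by (simp add: closed_set_def Sup_compacts_below) (auto simp: compacts_below_def)
  show ?thesis
  proof (rule that[of "\<Union>n. points n" "\<lambda>x. near (compacts_below x)"])
    fix x y assume xy: "x \<in> carrier L" "y \<in> carrier L" "near (compacts_below x) \<subseteq> near (compacts_below y)"
    have "compacts_below x \<subseteq> ?K" by (auto simp: compacts_below_def)
    then have "compacts_below x \<subseteq> compacts_below y" using xy(3) by (rule near_reflects)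
    then show "x \<sqsubseteq> y" using xy by (intro compacts_below_reflects)
  next
    fix S assume S: "S \<subseteq> carrier L" "S \<noteq> {}"
    show "near (compacts_below (\<Sqinter>S)) = (\<Inter>x\<in>S. near (compacts_below x))"
      using S near_Inter[of "compacts_below ` S"] by (simp add: compacts_below_Inf image_image)
    show "near (compacts_below (\<Squnion>S)) \<subseteq> (\<Union>x\<in>S. near (compacts_below x))\<^sup>*"
      using near_join[of "compacts_below ` S"] S closed
      unfolding compacts_below_Sup[OF S(1)] image_image by blast
  next
    fix x assume "x \<in> carrier L"
    then show "trans (near (compacts_below x))" by (intro trans_near closed)
  qed (use assms in \<open>simp_all add: countable_points infinite_points near_subset near_refl sym_near
        del: UN_iff\<close>)
qed

text \<open>One family of permutation groups serves for all three lattices: the groups are closed even in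
  the space of all maps, and their joins are contained in every monoid that contains the joinands.\<close>

lemma (in algebraic_lattice) group_representation:
  fixes X :: "'x set"
  assumes X: "countable X" "infinite X" and "countable {c. compact_element L c}"
  obtains g :: "'a \<Rightarrow> ('x \<Rightarrow> 'x) set"
  where "\<And>x. x \<in> carrier L \<Longrightarrow> g x \<in> local_groups X" "\<And>x. x \<in> carrier L \<Longrightarrow> g x \<in> local_monoids X"
    and "inj_on g (carrier L)"
    and "\<And>S. S \<subseteq> carrier L \<Longrightarrow> S \<noteq> {} \<Longrightarrow> g (\<Sqinter>S) = (\<Inter>x\<in>S. g x)"
    and "\<And>S P. S \<subseteq> carrier L \<Longrightarrow> S \<noteq> {} \<Longrightarrow> transformation_monoid X P \<Longrightarrow>
           (\<And>x. x \<in> S \<Longrightarrow> g x \<subseteq> P) \<Longrightarrow> g (\<Squnion>S) \<subseteq> P"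
proof -
  obtain A :: "'a point set" and E
    where A: "countable A" "infinite A"
      and sub: "\<And>x. E x \<subseteq> A \<times> A" and refl: "\<And>x a. a \<in> A \<Longrightarrow> (a, a) \<in> E x" and sym: "\<And>x. sym (E x)"
      and trans: "\<And>x. x \<in> carrier L \<Longrightarrow> trans (E x)"
      and reflects: "\<And>x y. x \<in> carrier L \<Longrightarrow> y \<in> carrier L \<Longrightarrow> E x \<subseteq> E y \<Longrightarrow> x \<sqsubseteq> y"
      and Inf: "\<And>S. S \<subseteq> carrier L \<Longrightarrow> S \<noteq> {} \<Longrightarrow> E (\<Sqinter>S) = (\<Inter>x\<in>S. E x)"
      and Sup: "\<And>S. S \<subseteq> carrier L \<Longrightarrow> S \<noteq> {} \<Longrightarrow> E (\<Squnion>S) \<subseteq> (\<Union>x\<in>S. E x)\<^sup>*"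
    using equivalence_representation[OF assms(3)] by blast
  define G where "G = finitary_perms (A \<times> A)"
  \<comment> \<open>X and the group of all finitary permutations of A are both countably infinite\<close>
  obtain e :: "'x \<Rightarrow> nat" where e: "bij_betw e X UNIV"
    using countableE_infinite[OF X] by blast
  obtain e' :: "('a point \<Rightarrow> 'a point) \<Rightarrow> nat" where e': "bij_betw e' G UNIV"
    using countableE_infinite[OF countable_finitary_perms[OF A(1)] infinite_finitary_perms[OF A(2)]]
    unfolding G_def by blast
  interpret R: regular_representation X G "inv_into G e' \<circ> e"
  proof
    show "bij_betw (inv_into G e' \<circ> e) X G"
      by (rule bij_betw_trans[OF e bij_betw_inv_into[OF e']])
    show "id \<in> G" unfolding G_def by (rule finitary_perms_id)
    show "\<sigma> \<circ> \<tau> \<in> G" if "\<sigma> \<in> G" "\<tau> \<in> G" for \<sigma> \<tau>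
      using that unfolding G_def by (intro finitary_perms_comp) (auto simp: trans_def)
    show "bij \<sigma>" if "\<sigma> \<in> G" for \<sigma>
      using that by (simp add: G_def finitary_perms_def)
  qed
  define H where "H x = finitary_perms (E x)" for x
  have HG: "H x \<subseteq> G" for x unfolding H_def G_def by (rule finitary_perms_mono[OF sub])
  have H: "id \<in> H x" "\<sigma> \<in> H x \<Longrightarrow> \<tau> \<in> H x \<Longrightarrow> \<sigma> \<circ> \<tau> \<in> H x" "\<sigma> \<in> H x \<Longrightarrow> inv_into UNIV \<sigma> \<in> H x"
    if "x \<in> carrier L" for x \<sigma> \<tau>
    unfolding H_def
    using finitary_perms_id finitary_perms_comp[OF trans[OF that]] finitary_perms_inv[OF sym] by blast+
  show ?thesis
  proof (rule that[of "\<lambda>x. R.translation ` H x"])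
    fix x assume "x \<in> carrier L"
    then show "R.translation ` H x \<in> local_groups X" "R.translation ` H x \<in> local_monoids X"
      using R.translation_group_local[OF HG] R.translation_monoid_local[OF HG] H by blast+
  next
    show "inj_on (\<lambda>x. R.translation ` H x) (carrier L)"
    proof (rule inj_onI)
      fix x y assume xy: "x \<in> carrier L" "y \<in> carrier L" "R.translation ` H x = R.translation ` H y"
      then have "H x = H y"
        using inj_on_image_eq_iff[OF R.inj_on_translation HG HG] by blast
      moreover have "E u \<subseteq> E v" if "H u \<subseteq> H v" for u v
        by (rule finitary_perms_reflects[OF sym sym _ that[unfolded H_def]]) (use sub refl in blast)
      ultimately show "x = y" using xy reflects by (intro le_antisym) auto
    qed
  next
    fix S assume S: "S \<subseteq> carrier L" "S \<noteq> {}"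
    have "H (\<Sqinter>S) = (\<Inter>x\<in>S. H x)"
      unfolding H_def Inf[OF S] by (rule finitary_perms_Inter[OF S(2)])
    then show "R.translation ` H (\<Sqinter>S) = (\<Inter>x\<in>S. R.translation ` H x)"
      using R.translation_Inter[OF S(2) HG] by simp
    fix P assume P: "transformation_monoid X P" and SP: "\<And>x. x \<in> S \<Longrightarrow> R.translation ` H x \<subseteq> P"
    \<comment> \<open>pull P back along the regular representation\<close>
    let ?S = "{\<sigma> \<in> G. R.translation \<sigma> \<in> P}"
    have "finitary_perms (E (\<Squnion>S)) \<subseteq> ?S"
    proof (rule finitary_perms_join[where I = S and E' = E])
      show "sym (E (\<Squnion>S))" "\<And>x. sym (E x)" by (rule sym)+
      show "trans (E (\<Squnion>S))" using S by (intro trans) simp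
      show "E (\<Squnion>S) \<subseteq> (\<Union>x\<in>S. E x)\<^sup>*" by (rule Sup[OF S])
      show "id \<in> ?S"
        using P R.id_in by (simp add: R.translation_id transformation_monoid_def)
      show "\<sigma> \<circ> \<tau> \<in> ?S" if "\<sigma> \<in> ?S" "\<tau> \<in> ?S" for \<sigma> \<tau>
      proof -
        have "compose X (R.translation \<sigma>) (R.translation \<tau>) \<in> P"
          using P that unfolding transformation_monoid_def by blast
        then show ?thesis using that by (simp add: R.compose_translation R.comp_in)
      qed
      show "finitary_perms (E x) \<subseteq> ?S" if "x \<in> S" for x
        using SP[OF that] HG[of x] unfolding H_def by blast
    qed
    then show "R.translation ` H (\<Squnion>S) \<subseteq> P" unfolding H_def by blast
  qed
qed

theorem theorem5:
  fixes X :: "'a set" and L :: "('l, 'm) gorder_scheme"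
  assumes "countable X" and "infinite X"
    and "algebraic_lattice L" and "countable {c. compact_element L c}"
  shows "iso_to_complete_sublattice L (Cl_loc X) \<and>
         iso_to_complete_sublattice L (Gr_loc X) \<and>
         iso_to_complete_sublattice L (Mon_loc X)"
proof -
  interpret L: algebraic_lattice L by (rule assms(3))
  have L: "complete_lattice L" by (rule L.complete_lattice_axioms)
  obtain g where groups: "\<And>x. x \<in> carrier L \<Longrightarrow> g x \<in> local_groups X"
    and monoids: "\<And>x. x \<in> carrier L \<Longrightarrow> g x \<in> local_monoids X"
    and inj: "inj_on g (carrier L)"
    and Inf: "\<And>S. S \<subseteq> carrier L \<Longrightarrow> S \<noteq> {} \<Longrightarrow> g (\<Sqinter>\<^bsub>L\<^esub>S) = (\<Inter>x\<in>S. g x)"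
    and Sup: "\<And>S P. S \<subseteq> carrier L \<Longrightarrow> S \<noteq> {} \<Longrightarrow> transformation_monoid X P \<Longrightarrow>
           (\<And>x. x \<in> S \<Longrightarrow> g x \<subseteq> P) \<Longrightarrow> g (\<Squnion>\<^bsub>L\<^esub>S) \<subseteq> P"
    using L.group_representation[OF assms(1,2,4)] by blast
  have maps: "g x \<subseteq> X \<rightarrow>\<^sub>E X" if "x \<in> carrier L" for x
    by (rule local_monoids_subset[OF monoids[OF that]])
  have "iso_to_complete_sublattice L (Gr_loc X)"
    by (rule iso_to_complete_sublatticeI[OF L local_groups_top local_groups_subset local_groups_Inter
          groups inj Inf Sup[OF _ _ local_group_imp_transformation_monoid]])
  moreover have "iso_to_complete_sublattice L (Mon_loc X)"
  proof (rule iso_to_complete_sublatticeI[OF L local_monoids_top local_monoids_subset local_monoids_Inter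
          monoids inj Inf Sup])
    show "transformation_monoid X P" if "P \<in> local_monoids X" for P
      using that by (simp add: local_monoids_def)
  qed
  moreover have "iso_to_complete_sublattice L (Cl_loc X)"
  proof (rule iso_to_complete_sublatticeI[OF L local_clones_top local_clones_subset local_clones_Inter,
        where h = "\<lambda>x. essentially_unary X (g x)"])
    show "essentially_unary X (g x) \<in> local_clones X" if "x \<in> carrier L" for x
      by (rule essentially_unary_local[OF monoids[OF that]])
    show "inj_on (\<lambda>x. essentially_unary X (g x)) (carrier L)"
    proof (rule inj_onI)
      fix x y assume xy: "x \<in> carrier L" "y \<in> carrier L" "essentially_unary X (g x) = essentially_unary X (g y)"
      then have "g x = g y"
        using essentially_unary_reflects maps by (metis subset_antisym order_refl)
      then show "x = y" using inj xy by (simp add: inj_on_def)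
    qed
    fix S assume S: "S \<subseteq> carrier L" "S \<noteq> {}"
    show "essentially_unary X (g (\<Sqinter>\<^bsub>L\<^esub>S)) = (\<Inter>x\<in>S. essentially_unary X (g x))"
      unfolding Inf[OF S] using S maps by (intro essentially_unary_Inter) auto
    fix C assume C: "C \<in> local_clones X" "\<And>x. x \<in> S \<Longrightarrow> essentially_unary X (g x) \<subseteq> C"
    show "essentially_unary X (g (\<Squnion>\<^bsub>L\<^esub>S)) \<subseteq> C"
    proof (rule essentially_unary_join[where I = S and N = g])
      show "clone X C" using C(1) by (simp add: local_clones_def)
      show "g (\<Squnion>\<^bsub>L\<^esub>S) \<subseteq> X \<rightarrow>\<^sub>E X" using S by (intro maps) simp
      show "g x \<subseteq> X \<rightarrow>\<^sub>E X" if "x \<in> S" for x using that S by (intro maps) auto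
      show "g (\<Squnion>\<^bsub>L\<^esub>S) \<subseteq> P" if "transformation_monoid X P" "\<And>x. x \<in> S \<Longrightarrow> g x \<subseteq> P" for P
        by (rule Sup[OF S that])
    qed (rule C(2))
  qed
  ultimately show ?thesis by blast
qed

end
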